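(* Let $\mathcal{P}$ be a finite chiral $n$-polytope such that $X(\mathcal{P})$ is simple, and let $\mathcal{Q}$ be a finite directly regular $n$-polytope. If $|X(\mathcal{P})|$ does not divide $|\Gamma^+(\mathcal{Q})|$, then $\mathcal{P}\diamond\mathcal{Q}$ is chiral and $X(\mathcal{P}\diamond\mathcal{Q})=X(\mathcal{P})$ (in particular $X(\mathcal{P}\diamond\mathcal{Q})\cong X(\mathcal{P})$).
   Context: All polytopes are abstract polytopes. A regular polytope is directly regular if its rotation group $\Gamma^+(\mathcal{P})$, generated by $\sigma_i=\rho_{i-1}\rho_i$ ($\rho_0,\dots,\rho_{n-1}$ the standard generating involutions relative to a base flag), has index $2$ in the automorphism group. A polytope is chiral if its automorphism group has two orbits on flags, adjacent flags lying in distinct orbits; then $\Gamma^+(\mathcal{P})$ is the full automorphism group, generated by standard rotations $\sigma_1,\dots,\sigma_{n-1}$. Let $W^+=\langle \sigma_1,\dots,\sigma_{n-1}\mid (\sigma_i\cdots\sigma_j)^2=1,\ 1\le i<j\le n-1\rangle$; each such $\Gamma^+(\mathcal{P})$ equals $W^+/M$ for a normal subgroup $M$, generators corresponding. Let $w\mapsto\overline{w}$ be the automorphism of $W^+$ with $\sigma_1\mapsto\sigma_1^{-1}$, $\sigma_2\mapsto\sigma_1^2\sigma_2$, $\sigma_j\mapsto\sigma_j$ ($j\ge3$). Mix: if $\Gamma^+(\mathcal{P})=W^+/M$ and $\Gamma^+(\mathcal{Q})=W^+/K$, the mix $\mathcal{P}\diamond\mathcal{Q}$ is the (flag-connected pre-)polytope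 whose rotation group is the subgroup of $\Gamma^+(\mathcal{P})\times\Gamma^+(\mathcal{Q})$ generated by $(\sigma_i,\sigma_i')$, isomorphic to $W^+/N$ with $N=M\cap K$; it is chiral if $\overline N\ne N$ and directly regular otherwise. Chirality group: for rotation group $W^+/N$, $X=N\overline{N}/N$, the kernel of the natural epimorphism $W^+/N\to W^+/(N\overline N)$. *)

theory Defs
  imports
    "HOL-Algebra.Bij"
    "HOL-Algebra.Elementary_Groups"
    "HOL-Algebra.Group_Action"
    "HOL-Algebra.SimpleGroups"
begin

text \<open>
  Abstract polytopes.  A poset is given by its reflexive order relation \<open>r\<close>; its faces are the
  elements of \<open>Field r\<close>, and the flags are the maximal chains.
\<close>

definition flags :: "'a rel \<Rightarrow> 'a set set" where
  "flags r = {C \<in> Chains r. \<forall>D \<in> Chains r. C \<subseteq> D \<longrightarrow> D = C}"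

text \<open>
  A longest chain with top element \<open>F\<close> contains one face of each rank \<open>-1, 0, \<dots>, rank F\<close>.
\<close>

definition face_rank :: "'a rel \<Rightarrow> 'a \<Rightarrow> int" where
  "face_rank r F = int (Max {card C |C. C \<in> Chains r \<and> C \<subseteq> {G. (G, F) \<in> r}}) - 2"

definition adjacent_flags :: "'a rel \<Rightarrow> 'a set \<Rightarrow> 'a set \<Rightarrow> bool" where
  "adjacent_flags r C D \<longleftrightarrow>
     C \<in> flags r \<and> D \<in> flags r \<and> card (C - D) = 1 \<and> card (D - C) = 1"

definition abstract_polytope :: "nat \<Rightarrow> 'a rel \<Rightarrow> bool" where
  "abstract_polytope n r \<longleftrightarrow>
     Partial_order r \<and>
     (\<exists>F \<in> Field r. \<forall>G \<in> Field r. (F, G) \<in> r) \<and>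
     (\<exists>G \<in> Field r. \<forall>F \<in> Field r. (F, G) \<in> r) \<and>
     (\<forall>C \<in> flags r. card C = n + 2) \<and>
     (\<forall>C \<in> flags r. \<forall>D \<in> flags r.
        (C, D) \<in> {(A, B). adjacent_flags r A B \<and> C \<inter> D \<subseteq> A \<and> C \<inter> D \<subseteq> B}\<^sup>*) \<and>
     (\<forall>F G. (F, G) \<in> r \<and> face_rank r G = face_rank r F + 2 \<longrightarrow>
        card {H. (F, H) \<in> r \<and> (H, G) \<in> r \<and> H \<noteq> F \<and> H \<noteq> G} = 2)"

text \<open>The flag that differs from \<open>C\<close> exactly in its face of rank \<open>i\<close>.\<close>

definition adj_flag :: "'a rel \<Rightarrow> nat \<Rightarrow> 'a set \<Rightarrow> 'a set" where
  "adj_flag r i C = (THE D. D \<in> flags r \<and> D \<noteq> C \<and>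
     {F \<in> D. face_rank r F \<noteq> int i} = {F \<in> C. face_rank r F \<noteq> int i})"

definition aut_group :: "'a rel \<Rightarrow> ('a \<Rightarrow> 'a) monoid" where
  "aut_group r = BijGroup (Field r)
     \<lparr>carrier := {f \<in> Bij (Field r).
        \<forall>x \<in> Field r. \<forall>y \<in> Field r. (f x, f y) \<in> r \<longleftrightarrow> (x, y) \<in> r}\<rparr>"

definition flag_orbits :: "'a rel \<Rightarrow> 'a set set set" where
  "flag_orbits r = orbits (aut_group r) (flags r) (\<lambda>f C. f ` C)"

text \<open>
  Rotation groups with distinguished generators: a pair of a group and the sequence of generators,
  of which the entries \<open>1, \<dots>, n - 1\<close> are the relevant ones for an \<open>n\<close>-polytope.
\<close>

type_synonym 'g rotation_group = "'g monoid \<times> (nat \<Rightarrow> 'g)"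

definition regular_polytope :: "nat \<Rightarrow> 'a rel \<Rightarrow> bool" where
  "regular_polytope n r \<longleftrightarrow> abstract_polytope n r \<and> card (flag_orbits r) = 1"

definition std_reflection :: "'a rel \<Rightarrow> 'a set \<Rightarrow> nat \<Rightarrow> 'a \<Rightarrow> 'a" where
  "std_reflection r C i = (THE f. f \<in> carrier (aut_group r) \<and> f ` C = adj_flag r i C)"

definition regular_rotation :: "'a rel \<Rightarrow> 'a set \<Rightarrow> nat \<Rightarrow> 'a \<Rightarrow> 'a" where
  "regular_rotation r C i =
     std_reflection r C (i - 1) \<otimes>\<^bsub>aut_group r\<^esub> std_reflection r C i"

definition regular_rotation_group :: "nat \<Rightarrow> 'a rel \<Rightarrow> 'a set \<Rightarrow> ('a \<Rightarrow> 'a) rotation_group" where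
  "regular_rotation_group n r C =
     (subgroup_generated (aut_group r) (regular_rotation r C ` {1..<n}), regular_rotation r C)"

text \<open>
  The index does not depend on the base flag: by flag-transitivity, changing the flag conjugates
  the rotation subgroup.
\<close>

definition directly_regular_polytope :: "nat \<Rightarrow> 'a rel \<Rightarrow> bool" where
  "directly_regular_polytope n r \<longleftrightarrow> regular_polytope n r \<and>
     (\<exists>C \<in> flags r.
        card (rcosets\<^bsub>aut_group r\<^esub> carrier (fst (regular_rotation_group n r C))) = 2)"

definition chiral_polytope :: "nat \<Rightarrow> 'a rel \<Rightarrow> bool" where
  "chiral_polytope n r \<longleftrightarrow> abstract_polytope n r \<and> card (flag_orbits r) = 2 \<and>
     (\<forall>C D. adjacent_flags r C D \<longrightarrow> (\<forall>S \<in> flag_orbits r. \<not> (C \<in> S \<and> D \<in> S)))"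

text \<open>
  The standard rotation fixes all faces of the base flag \<open>C\<close> except those of rank \<open>i - 1\<close> and
  \<open>i\<close>, and rotates the corresponding polygonal section by one step.  Products in
  \<^const>\<open>aut_group\<close> are read as compositions of maps acting from the left; with this convention
  it is the direction sending \<open>C\<close> to the \<open>i\<close>-adjacent flag of its \<open>(i - 1)\<close>-adjacent
  flag (the image of \<open>C\<close> under \<^const>\<open>regular_rotation\<close> in the regular case) which gives
  the relations \<open>(\<sigma>\<^sub>i \<cdots> \<sigma>\<^sub>j)\<^sup>2 = 1\<close>.  For automorphisms acting from the right it would be the inverse
  map; inversion is an isomorphism between the two conventions and matches the generators.
\<close>

definition chiral_rotation :: "'a rel \<Rightarrow> 'a set \<Rightarrow> nat \<Rightarrow> 'a \<Rightarrow> 'a" where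
  "chiral_rotation r C i =
     (THE f. f \<in> carrier (aut_group r) \<and> f ` C = adj_flag r i (adj_flag r (i - 1) C))"

definition chiral_rotation_group :: "'a rel \<Rightarrow> 'a set \<Rightarrow> ('a \<Rightarrow> 'a) rotation_group" where
  "chiral_rotation_group r C = (aut_group r, chiral_rotation r C)"

text \<open>
  Groups given by generators \<open>S\<close> and relators \<open>R\<close>.  A word is a list of letters
  \<open>(x, True)\<close>, standing for \<open>x\<close>, and \<open>(x, False)\<close>, standing for the inverse of \<open>x\<close>.
\<close>

type_synonym 'x word = "('x \<times> bool) list"

definition words :: "'x set \<Rightarrow> 'x word set" where
  "words S = lists (S \<times> UNIV)"

inductive_set pres_rel :: "'x set \<Rightarrow> 'x word set \<Rightarrow> 'x word rel"
  for S :: "'x set" and R :: "'x word set" where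
  refl: "u \<in> words S \<Longrightarrow> (u, u) \<in> pres_rel S R"
| sym: "(u, v) \<in> pres_rel S R \<Longrightarrow> (v, u) \<in> pres_rel S R"
| trans: "(u, v) \<in> pres_rel S R \<Longrightarrow> (v, w) \<in> pres_rel S R \<Longrightarrow> (u, w) \<in> pres_rel S R"
| cancel: "u \<in> words S \<Longrightarrow> v \<in> words S \<Longrightarrow> x \<in> S \<Longrightarrow>
    (u @ [(x, b), (x, \<not> b)] @ v, u @ v) \<in> pres_rel S R"
| relator: "u \<in> words S \<Longrightarrow> v \<in> words S \<Longrightarrow> w \<in> R \<Longrightarrow> w \<in> words S \<Longrightarrow>
    (u @ w @ v, u @ v) \<in> pres_rel S R"

definition presented_group :: "'x set \<Rightarrow> 'x word set \<Rightarrow> 'x word set monoid" where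
  "presented_group S R =
     \<lparr>carrier = words S // pres_rel S R,
      monoid.mult = \<lambda>A B. \<Union>u \<in> A. \<Union>v \<in> B. pres_rel S R `` {u @ v},
      one = pres_rel S R `` {[]}\<rparr>"

fun word_eval :: "('g, 'm) monoid_scheme \<Rightarrow> ('x \<Rightarrow> 'g) \<Rightarrow> 'x word \<Rightarrow> 'g" where
  "word_eval G s [] = \<one>\<^bsub>G\<^esub>"
| "word_eval G s ((x, b) # w) = (if b then s x else inv\<^bsub>G\<^esub> s x) \<otimes>\<^bsub>G\<^esub> word_eval G s w"

definition W_plus :: "nat \<Rightarrow> nat word set monoid" where
  "W_plus n = presented_group {1..<n}
     {w @ w |w. \<exists>i j. 1 \<le> i \<and> i < j \<and> j < n \<and> w = map (\<lambda>k. (k, True)) [i..<Suc j]}"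

definition W_gen :: "nat \<Rightarrow> nat \<Rightarrow> nat word set" where
  "W_gen n i = (THE A. A \<in> carrier (W_plus n) \<and> [(i, True)] \<in> A)"

text \<open>
  The homomorphism from \<^const>\<open>W_plus\<close> that sends the generators to the elements \<open>s i\<close>.  It is
  well defined when these satisfy the defining relations: then all words in a class \<open>A\<close> have
  the same value.
\<close>

definition W_hom :: "nat \<Rightarrow> ('g, 'm) monoid_scheme \<Rightarrow> (nat \<Rightarrow> 'g) \<Rightarrow> nat word set \<Rightarrow> 'g" where
  "W_hom n G s = (\<lambda>A \<in> carrier (W_plus n). the_elem (word_eval G s ` A))"

definition W_bar :: "nat \<Rightarrow> nat word set \<Rightarrow> nat word set" where
  "W_bar n = W_hom n (W_plus n)
     (\<lambda>i. if i = 1 then inv\<^bsub>W_plus n\<^esub> W_gen n 1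
          else if i = 2 then W_gen n 1 [^]\<^bsub>W_plus n\<^esub> (2::nat) \<otimes>\<^bsub>W_plus n\<^esub> W_gen n 2
          else W_gen n i)"

text \<open>The subgroup \<open>N\<close> for which the rotation group is \<open>W\<^sup>+/N\<close>, generators corresponding.\<close>

definition rot_kernel :: "nat \<Rightarrow> 'g rotation_group \<Rightarrow> nat word set set" where
  "rot_kernel n = (\<lambda>(G, s). kernel (W_plus n) G (W_hom n G s))"

text \<open>
  Chirality and direct regularity of the pre-polytope with a given rotation group.  This is the
  meaning of these words for a mix, which need not be a polytope.
\<close>

definition chiral_rot :: "nat \<Rightarrow> 'g rotation_group \<Rightarrow> bool" where
  "chiral_rot n R \<longleftrightarrow> W_bar n ` rot_kernel n R \<noteq> rot_kernel n R"

text \<open>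
  The subgroup \<open>N (W_bar n ` N) / N\<close> of \<open>W\<^sup>+/N\<close>, transported to the rotation group along
  the isomorphism of \<open>W\<^sup>+/N\<close> with the latter.
\<close>

definition chirality_group :: "nat \<Rightarrow> 'g rotation_group \<Rightarrow> 'g monoid" where
  "chirality_group n = (\<lambda>(G, s). G
     \<lparr>carrier := W_hom n G s `
        (rot_kernel n (G, s) <#>\<^bsub>W_plus n\<^esub> (W_bar n ` rot_kernel n (G, s)))\<rparr>)"

definition mix :: "nat \<Rightarrow> 'g rotation_group \<Rightarrow> 'h rotation_group \<Rightarrow> ('g \<times> 'h) rotation_group" where
  "mix n = (\<lambda>(G, s) (H, t).
     (subgroup_generated (G \<times>\<times> H) ((\<lambda>i. (s i, t i)) ` {1..<n}), \<lambda>i. (s i, t i)))"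

end

theory Submission
  imports Defs
begin

text \<open>
  Let \<open>M\<close> and \<open>K\<close> be the kernels of the maps from \<open>W\<^sup>+\<close> to the rotation groups of \<open>P\<close> and \<open>Q\<close>.
  In a regular polytope the bar automorphism is conjugation by \<open>\<rho>\<^sub>0\<close>, hence \<open>K\<close> is bar-invariant and
  the chirality group of the mix is the image of \<open>bar M \<inter> K\<close> in the product; it lies in the first
  factor.  There it is a normal subgroup of \<open>X(P)\<close>, the image of \<open>bar M\<close>.  Were it trivial,
  \<open>X(P)\<close> would be a quotient of the image of \<open>bar M\<close> in the rotation group of \<open>Q\<close>, against the
  hypothesis on orders; by simplicity it is all of \<open>X(P)\<close>.

  The relations of \<open>W\<^sup>+\<close> are checked on flags: automorphisms commute with passing to adjacent flags
  and are determined by their effect on one flag, and \<open>\<sigma>\<^sub>i \<cdots> \<sigma>\<^sub>j\<close> sends the base flag to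
  the \<open>j\<close>-adjacent flag of its \<open>(i - 1)\<close>-adjacent flag, where the two adjacencies commute.
\<close>

section \<open>Presented groups and the group \<open>W\<^sup>+\<close>\<close>

lemma append_in_words [simp]: "u @ v \<in> words S \<longleftrightarrow> u \<in> words S \<and> v \<in> words S"
  by (auto simp: words_def)

lemma Nil_in_words [simp]: "[] \<in> words S"
  by (simp add: words_def)

lemma Cons_in_words [simp]: "x # w \<in> words S \<longleftrightarrow> fst x \<in> S \<and> w \<in> words S"
  by (cases x) (auto simp: words_def)

lemma pres_rel_words: "(u, v) \<in> pres_rel S R \<Longrightarrow> u \<in> words S \<and> v \<in> words S"
  by (induction rule: pres_rel.induct) auto

lemma equiv_pres_rel: "equiv (words S) (pres_rel S R)"
proof (rule equivI)
  show "pres_rel S R \<subseteq> words S \<times> words S" using pres_rel_words by auto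
  show "refl_on (words S) (pres_rel S R)" by (simp add: refl_on_def pres_rel.refl)
  show "sym (pres_rel S R)" using pres_rel.sym by (auto simp: sym_def)
  show "trans (pres_rel S R)" using pres_rel.trans by (metis transI)
qed

lemma pres_rel_append_left:
  "(u, v) \<in> pres_rel S R \<Longrightarrow> w \<in> words S \<Longrightarrow> (w @ u, w @ v) \<in> pres_rel S R"
proof (induction rule: pres_rel.induct)
  case (cancel u v x b)
  then show ?case using pres_rel.cancel[of "w @ u" S v x b R] by simp
next
  case (relator u v w')
  then show ?case using pres_rel.relator[of "w @ u" S v w' R] by simp
qed (auto intro: pres_rel.refl pres_rel.sym pres_rel.trans)

lemma pres_rel_append_right:
  "(u, v) \<in> pres_rel S R \<Longrightarrow> w \<in> words S \<Longrightarrow> (u @ w, v @ w) \<in> pres_rel S R"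
proof (induction rule: pres_rel.induct)
  case (cancel u v x b)
  then show ?case using pres_rel.cancel[of u S "v @ w" x b R] by simp
next
  case (relator u v w')
  then show ?case using pres_rel.relator[of u S "v @ w" w' R] by simp
qed (auto intro: pres_rel.refl pres_rel.sym pres_rel.trans)

lemma pres_rel_append:
  "(u, u') \<in> pres_rel S R \<Longrightarrow> (v, v') \<in> pres_rel S R \<Longrightarrow> (u @ v, u' @ v') \<in> pres_rel S R"
  using pres_rel_append_left pres_rel_append_right pres_rel.trans pres_rel_words by metis

definition word_inv :: "'x word \<Rightarrow> 'x word" where
  "word_inv w = rev (map (\<lambda>(x, b). (x, \<not> b)) w)"

lemma word_inv_in_words: "w \<in> words S \<Longrightarrow> word_inv w \<in> words S"
  by (induction w) (auto simp: word_inv_def)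

lemma word_inv_cancel: "w \<in> words S \<Longrightarrow> (word_inv w @ w, []) \<in> pres_rel S R"
proof (induction w)
  case Nil
  then show ?case by (simp add: word_inv_def pres_rel.refl)
next
  case (Cons y w)
  obtain x b where y: "y = (x, b)" by (cases y)
  \<comment> \<open>The inverse of \<open>y # w\<close> ends with the inverse letter of
    \<open>y\<close>, so the two letters meet in the middle and \<open>cancel\<close> removes them
    there; the sign \<open>\<not> \<not> b\<close> is the form in which \<open>cancel\<close>
    produces the second letter.\<close>
  have "(word_inv w @ [(x, \<not> b), (x, \<not> \<not> b)] @ w, word_inv w @ w) \<in> pres_rel S R"
    using Cons.prems y by (intro pres_rel.cancel) (auto intro: word_inv_in_words)
  then show ?case
    using Cons y pres_rel.trans by (fastforce simp: word_inv_def)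
qed

abbreviation pres_class :: "'x set \<Rightarrow> 'x word set \<Rightarrow> 'x word \<Rightarrow> 'x word set" where
  "pres_class S R w \<equiv> pres_rel S R `` {w}"

lemma pres_class_eq_iff:
  "u \<in> words S \<Longrightarrow> v \<in> words S \<Longrightarrow>
    pres_class S R u = pres_class S R v \<longleftrightarrow> (u, v) \<in> pres_rel S R"
  using equiv_pres_rel eq_equiv_class_iff by metis

lemma carrier_presented_group:
  "carrier (presented_group S R) = pres_class S R ` words S"
  by (auto simp: presented_group_def quotient_def)

lemma one_presented_group: "\<one>\<^bsub>presented_group S R\<^esub> = pres_class S R []"
  by (simp add: presented_group_def)

text \<open>The product in \<open>presented_group\<close> is a union over all pairs of
  representatives. As \<open>pres_rel\<close> is a congruence, each pair contributes the same class,
  and the union over two nonempty classes collapses to it.\<close>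

lemma mult_presented_group:
  assumes "u \<in> words S" "v \<in> words S"
  shows "pres_class S R u \<otimes>\<^bsub>presented_group S R\<^esub> pres_class S R v = pres_class S R (u @ v)"
proof -
  let ?A = "pres_class S R u" and ?B = "pres_class S R v" and ?C = "pres_class S R (u @ v)"
  have *: "pres_class S R (u' @ v') = ?C" if "u' \<in> ?A" "v' \<in> ?B" for u' v'
  proof -
    have "(u @ v, u' @ v') \<in> pres_rel S R" using that pres_rel_append by blast
    then show ?thesis using pres_class_eq_iff pres_rel_words by metis
  qed
  have "u \<in> ?A" "v \<in> ?B" using assms by (auto intro: pres_rel.refl)
  have "?A \<otimes>\<^bsub>presented_group S R\<^esub> ?B = (\<Union>u'\<in>?A. \<Union>v'\<in>?B. pres_class S R (u' @ v'))"
    by (simp add: presented_group_def)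
  also have "\<dots> = (\<Union>u'\<in>?A. \<Union>v'\<in>?B. ?C)"
    by (intro SUP_cong HOL.refl *)
  also have "\<dots> = ?C"
    using \<open>u \<in> ?A\<close> \<open>v \<in> ?B\<close> by blast
  finally show ?thesis .
qed

lemma group_presented_group: "group (presented_group S R)"
proof (rule groupI)
  fix A assume "A \<in> carrier (presented_group S R)"
  then obtain w where w: "w \<in> words S" "A = pres_class S R w"
    by (auto simp: carrier_presented_group)
  show "\<exists>B\<in>carrier (presented_group S R).
    B \<otimes>\<^bsub>presented_group S R\<^esub> A = \<one>\<^bsub>presented_group S R\<^esub>"
  proof
    show "pres_class S R (word_inv w) \<in> carrier (presented_group S R)"
      using w word_inv_in_words by (auto simp: carrier_presented_group)
    show "pres_class S R (word_inv w) \<otimes>\<^bsub>presented_group S R\<^esub> A = \<one>\<^bsub>presented_group S R\<^esub>"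
      using w word_inv_in_words[OF w(1)] word_inv_cancel[OF w(1)]
      by (simp add: mult_presented_group one_presented_group pres_class_eq_iff)
  qed
qed (auto simp: carrier_presented_group mult_presented_group one_presented_group)

section \<open>Values of words in a group\<close>

lemma word_eval_closed:
  assumes "group G" "s ` S \<subseteq> carrier G" "w \<in> words S"
  shows "word_eval G s w \<in> carrier G"
proof -
  interpret group G by fact
  show ?thesis using assms(2,3)
  proof (induction w)
    case (Cons y w)
    then show ?case by (cases y) auto
  qed simp
qed

lemma word_eval_append:
  assumes "group G" "s ` S \<subseteq> carrier G" "u \<in> words S" "v \<in> words S"
  shows "word_eval G s (u @ v) = word_eval G s u \<otimes>\<^bsub>G\<^esub> word_eval G s v"
proof -
  interpret group G by fact
  note closed = word_eval_closed[OF assms(1,2)]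
  show ?thesis using assms(2,3)
  proof (induction u)
    case Nil
    then show ?case using closed[OF assms(4)] by simp
  next
    case (Cons y u)
    then show ?case using closed[OF assms(4)] closed[of u]
      by (cases y) (auto simp: m_assoc image_subset_iff)
  qed
qed

text \<open>The half of von Dyck's theorem that makes \<open>W_hom\<close> well defined. Only
  cancellation and insertion of relators need an argument; the closure rules are trivial for
  equality of values.\<close>

lemma word_eval_pres_rel:
  assumes "group G" "s ` S \<subseteq> carrier G"
    and R: "\<And>w. w \<in> R \<Longrightarrow> w \<in> words S \<Longrightarrow> word_eval G s w = \<one>\<^bsub>G\<^esub>"
  shows "(u, v) \<in> pres_rel S R \<Longrightarrow> word_eval G s u = word_eval G s v"
proof (induction rule: pres_rel.induct)
  interpret group G by fact
  note closed = word_eval_closed[OF assms(1,2)]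
  note append = word_eval_append[OF assms(1,2)]
  {
    case (cancel u v x b)
    have x: "s x \<in> carrier G" using cancel assms(2) by auto
    have "word_eval G s ([(x, b), (x, \<not> b)] @ v) = word_eval G s v"
      using closed[OF cancel(2)] x by (cases b) (simp_all add: m_assoc[symmetric])
    then show ?case using cancel append[of u "[(x, b), (x, \<not> b)] @ v"] append[of u v] by simp
  next
    case (relator u v w)
    then show ?case using append closed R by simp
  }
qed auto

lemma word_eval_hom:
  assumes "group G" "group H" "h \<in> hom G H" "s ` S \<subseteq> carrier G" "w \<in> words S"
  shows "h (word_eval G s w) = word_eval H (h \<circ> s) w"
proof -
  interpret group_hom G H h using assms by (simp add: group_hom_def group_hom_axioms_def)
  show ?thesis using assms(4,5)
  proof (induction w)
    case (Cons y w)
    then show ?case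
      using word_eval_closed[OF assms(1,4), of w] by (cases y) (auto simp: image_subset_iff)
  qed simp
qed

lemma word_eval_cong:
  "w \<in> words S \<Longrightarrow> (\<And>x. x \<in> S \<Longrightarrow> s x = t x) \<Longrightarrow> word_eval G s w = word_eval G t w"
  by (induction w) auto

section \<open>The group W+ and its universal property\<close>

definition ascending :: "nat \<Rightarrow> nat \<Rightarrow> nat word" where
  "ascending i j = map (\<lambda>k. (k, True)) [i..<Suc j]"

lemma ascending_in_words: "1 \<le> i \<Longrightarrow> j < n \<Longrightarrow> ascending i j \<in> words {1..<n}"
  by (auto simp: ascending_def words_def)

lemma ascending_Cons: "i \<le> j \<Longrightarrow> ascending i j = (i, True) # ascending (Suc i) j"
  by (simp add: ascending_def upt_conv_Cons del: upt_Suc)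

definition W_rels :: "nat \<Rightarrow> nat word set" where
  "W_rels n = {ascending i j @ ascending i j |i j. 1 \<le> i \<and> i < j \<and> j < n}"

lemma W_plus_eq: "W_plus n = presented_group {1..<n} (W_rels n)"
  unfolding W_plus_def W_rels_def ascending_def by (rule arg_cong) blast

lemma group_W_plus: "group (W_plus n)"
  by (simp add: W_plus_eq group_presented_group)

lemma carrier_W_plus: "carrier (W_plus n) = pres_class {1..<n} (W_rels n) ` words {1..<n}"
  by (simp add: W_plus_eq carrier_presented_group)

text \<open>Classes of an equivalence relation are disjoint, so the description in
  \<open>W_gen\<close> has exactly one solution.\<close>

lemma W_gen_eq:
  assumes "i \<in> {1..<n}"
  shows "W_gen n i = pres_class {1..<n} (W_rels n) [(i, True)]"
  unfolding W_gen_def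
proof (rule the_equality)
  have i: "[(i, True)] \<in> words {1..<n}" using assms by simp
  show "pres_class {1..<n} (W_rels n) [(i, True)] \<in> carrier (W_plus n) \<and>
    [(i, True)] \<in> pres_class {1..<n} (W_rels n) [(i, True)]"
    using i pres_rel.refl unfolding carrier_W_plus by blast
  fix A assume A: "A \<in> carrier (W_plus n) \<and> [(i, True)] \<in> A"
  then obtain w where w: "w \<in> words {1..<n}" "A = pres_class {1..<n} (W_rels n) w"
    unfolding carrier_W_plus by blast
  then have "(w, [(i, True)]) \<in> pres_rel {1..<n} (W_rels n)" using A by simp
  then show "A = pres_class {1..<n} (W_rels n) [(i, True)]"
    using pres_class_eq_iff[OF w(1) i] w(2) by blast
qed

lemma W_gen_closed: "i \<in> {1..<n} \<Longrightarrow> W_gen n i \<in> carrier (W_plus n)"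
  by (auto simp: W_gen_eq carrier_W_plus)

text \<open>Expresses that the generators generate W+: each element, being the class of some word,
  is the value of that word.\<close>

lemma word_eval_W_gen:
  assumes "w \<in> words {1..<n}"
  shows "word_eval (W_plus n) (W_gen n) w = pres_class {1..<n} (W_rels n) w"
  using assms
proof (induction w)
  case Nil
  then show ?case by (simp add: W_plus_eq one_presented_group)
next
  case (Cons y w)
  interpret W: group "W_plus n" by (rule group_W_plus)
  let ?c = "pres_class {1..<n} (W_rels n)"
  obtain i b where y: "y = (i, b)" by (cases y)
  have i: "i \<in> {1..<n}" and w: "w \<in> words {1..<n}" using Cons.prems y by auto
  \<comment> \<open>A letter with sign \<open>False\<close> is evaluated by a group inverse, which
    has to be identified with the class of that letter.\<close>
  have "inv\<^bsub>W_plus n\<^esub> W_gen n i = ?c [(i, False)]"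
  proof (rule W.inv_equality)
    have "([(i, False), (i, True)], []) \<in> pres_rel {1..<n} (W_rels n)"
      using pres_rel.cancel[of "[]" "{1..<n}" "[]" i False] i by simp
    then show "?c [(i, False)] \<otimes>\<^bsub>W_plus n\<^esub> W_gen n i = \<one>\<^bsub>W_plus n\<^esub>"
      using i by (simp add: W_gen_eq W_plus_eq mult_presented_group one_presented_group
          pres_class_eq_iff)
    show "?c [(i, False)] \<in> carrier (W_plus n)"
      using i by (auto simp: carrier_W_plus)
  qed (rule W_gen_closed[OF i])
  then have "word_eval (W_plus n) (W_gen n) (y # w) = ?c [y] \<otimes>\<^bsub>W_plus n\<^esub> ?c w"
    using Cons w i y by (cases b) (auto simp: W_gen_eq)
  also have "\<dots> = ?c (y # w)"
    using mult_presented_group[of "[y]" "{1..<n}" w] Cons.prems by (simp add: W_plus_eq)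
  finally show ?case .
qed

text \<open>The tuples that may serve as images of the generators of W+. A relation is stated as a
  square in the group and not as the value of a doubled word, so that it can be checked by computing
  in the group.\<close>

definition W_relations :: "nat \<Rightarrow> ('g, 'm) monoid_scheme \<Rightarrow> (nat \<Rightarrow> 'g) \<Rightarrow> bool" where
  "W_relations n G s \<longleftrightarrow> s ` {1..<n} \<subseteq> carrier G \<and>
    (\<forall>i j. 1 \<le> i \<longrightarrow> i < j \<longrightarrow> j < n \<longrightarrow>
      word_eval G s (ascending i j) \<otimes>\<^bsub>G\<^esub> word_eval G s (ascending i j) = \<one>\<^bsub>G\<^esub>)"

lemma W_relations_closed: "W_relations n G s \<Longrightarrow> s ` {1..<n} \<subseteq> carrier G"
  by (simp add: W_relations_def)

lemma W_relations_square:
  "W_relations n G s \<Longrightarrow> 1 \<le> i \<Longrightarrow> i < j \<Longrightarrow> j < n \<Longrightarrow>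
    word_eval G s (ascending i j) \<otimes>\<^bsub>G\<^esub> word_eval G s (ascending i j) = \<one>\<^bsub>G\<^esub>"
  unfolding W_relations_def by blast

lemma word_eval_W_rels:
  assumes "group G" "W_relations n G s" "w \<in> W_rels n"
  shows "word_eval G s w = \<one>\<^bsub>G\<^esub>"
proof -
  obtain i j where ij: "1 \<le> i" "i < j" "j < n" and w: "w = ascending i j @ ascending i j"
    using assms(3) by (auto simp: W_rels_def)
  show ?thesis
    unfolding w W_relations_square[OF assms(2) ij, symmetric]
    using ascending_in_words[OF ij(1,3)] W_relations_closed[OF assms(2)]
    by (intro word_eval_append[OF assms(1)])
qed

text \<open>All words of a class have the same value, so the image of the class under
  \<open>word_eval\<close> is a singleton and \<open>the_elem\<close> extracts its element.\<close>

lemma W_hom_class: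
  assumes "group G" "W_relations n G s" "w \<in> words {1..<n}"
  shows "W_hom n G s (pres_class {1..<n} (W_rels n) w) = word_eval G s w"
proof -
  note s = W_relations_closed[OF assms(2)]
  then have "word_eval G s v = word_eval G s w" if "(w, v) \<in> pres_rel {1..<n} (W_rels n)" for v
    using word_eval_pres_rel[OF assms(1) _ _ that, of s] word_eval_W_rels[OF assms(1,2)] by simp
  then have "word_eval G s ` pres_class {1..<n} (W_rels n) w = {word_eval G s w}"
    using assms(3) pres_rel.refl by force
  then show ?thesis using assms(3) by (simp add: W_hom_def carrier_W_plus)
qed

lemma W_hom_hom:
  assumes "group G" "W_relations n G s"
  shows "W_hom n G s \<in> hom (W_plus n) G"
proof (rule homI)
  note s = W_relations_closed[OF assms(2)]
  fix A assume "A \<in> carrier (W_plus n)"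
  then obtain u where u: "u \<in> words {1..<n}" "A = pres_class {1..<n} (W_rels n) u"
    by (auto simp: carrier_W_plus)
  then show "W_hom n G s A \<in> carrier G"
    using W_hom_class[OF assms] word_eval_closed[OF assms(1) s] by simp
  fix B assume "B \<in> carrier (W_plus n)"
  then obtain v where v: "v \<in> words {1..<n}" "B = pres_class {1..<n} (W_rels n) v"
    by (auto simp: carrier_W_plus)
  have "A \<otimes>\<^bsub>W_plus n\<^esub> B = pres_class {1..<n} (W_rels n) (u @ v)"
    using u v by (simp add: W_plus_eq mult_presented_group)
  then show "W_hom n G s (A \<otimes>\<^bsub>W_plus n\<^esub> B) = W_hom n G s A \<otimes>\<^bsub>G\<^esub> W_hom n G s B"
    using u v W_hom_class[OF assms] word_eval_append[OF assms(1) s] by simp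
qed

lemma W_hom_gen:
  assumes "group G" "W_relations n G s" "i \<in> {1..<n}"
  shows "W_hom n G s (W_gen n i) = s i"
proof -
  interpret group G by fact
  have "s i \<in> carrier G" using assms(2,3) by (auto simp: W_relations_def)
  then show ?thesis
    using W_hom_class[OF assms(1,2), of "[(i, True)]"] W_gen_eq[OF assms(3)] assms(3) by simp
qed

text \<open>Both maps evaluate the same word in the images of the generators. Every later comparison
  of homomorphisms on W+ goes through this principle.\<close>

lemma W_plus_hom_eqI:
  assumes "group G" "h \<in> hom (W_plus n) G" "k \<in> hom (W_plus n) G"
    and "\<And>i. i \<in> {1..<n} \<Longrightarrow> h (W_gen n i) = k (W_gen n i)"
    and "x \<in> carrier (W_plus n)"
  shows "h x = k x"
proof -
  obtain w where w: "w \<in> words {1..<n}" "x = word_eval (W_plus n) (W_gen n) w"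
    using assms(5) word_eval_W_gen by (auto simp: carrier_W_plus)
  have gens: "W_gen n ` {1..<n} \<subseteq> carrier (W_plus n)" using W_gen_closed by auto
  have "h x = word_eval G (h \<circ> W_gen n) w"
    using word_eval_hom[OF group_W_plus assms(1,2) gens w(1)] w(2) by simp
  also have "\<dots> = word_eval G (k \<circ> W_gen n) w"
    by (rule word_eval_cong[OF w(1)]) (use assms(4) in simp)
  also have "\<dots> = k x"
    using word_eval_hom[OF group_W_plus assms(1,3) gens w(1)] w(2) by simp
  finally show ?thesis .
qed

text \<open>Allows W+ itself as the target of \<open>W_hom\<close>, as needed for
  \<open>W_bar\<close>; the squares are trivial because they are classes of relators.\<close>

lemma W_relations_W_gen: "W_relations n (W_plus n) (W_gen n)"
  unfolding W_relations_def
proof (intro conjI allI impI)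
  show "W_gen n ` {1..<n} \<subseteq> carrier (W_plus n)" using W_gen_closed by auto
  fix i j :: nat assume ij: "1 \<le> i" "i < j" "j < n"
  let ?w = "ascending i j"
  have w: "?w \<in> words {1..<n}" using ascending_in_words ij by blast
  have "?w @ ?w \<in> W_rels n" using ij unfolding W_rels_def by blast
  then have "(?w @ ?w, []) \<in> pres_rel {1..<n} (W_rels n)"
    using pres_rel.relator[of "[]" "{1..<n}" "[]" "?w @ ?w" "W_rels n"] w by simp
  then show "word_eval (W_plus n) (W_gen n) ?w \<otimes>\<^bsub>W_plus n\<^esub> word_eval (W_plus n) (W_gen n) ?w
    = \<one>\<^bsub>W_plus n\<^esub>"
    using w unfolding word_eval_W_gen[OF w]
    by (simp add: W_plus_eq mult_presented_group one_presented_group pres_class_eq_iff)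
qed

section \<open>The bar automorphism\<close>

definition bar_gen :: "('g, 'm) monoid_scheme \<Rightarrow> (nat \<Rightarrow> 'g) \<Rightarrow> nat \<Rightarrow> 'g" where
  "bar_gen G s i = (if i = 1 then inv\<^bsub>G\<^esub> s 1
    else if i = 2 then s 1 [^]\<^bsub>G\<^esub> (2::nat) \<otimes>\<^bsub>G\<^esub> s 2 else s i)"

lemma W_bar_eq: "W_bar n = W_hom n (W_plus n) (bar_gen (W_plus n) (W_gen n))"
  by (simp add: W_bar_def bar_gen_def[abs_def])

text \<open>Only products starting at index 1 or 2 contain changed generators. Those starting at 1
  keep their value, as the inverse of \<open>s 1\<close> cancels one of the two new factors. With
  \<open>a = s 1\<close> and \<open>b\<close> the old product from 2 to \<open>j\<close>, those
  starting at 2 become \<open>a a b\<close>; the old relations give \<open>a b a = b\<close>, and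
  hence the square of \<open>a a b\<close> equals the square of \<open>a b\<close>, which is
  one.\<close>

lemma W_relations_bar_gen:
  fixes G (structure)
  assumes "group G" "W_relations n G s"
  shows "W_relations n G (bar_gen G s)"
proof -
  interpret group G by fact
  let ?p = "\<lambda>s i j. word_eval G s (ascending i j)"
  note s = W_relations_closed[OF assms(2)]
  then have closed: "s i \<in> carrier G" if "1 \<le> i" "i < n" for i using that by auto
  have p_closed: "?p s i j \<in> carrier G" if "1 \<le> i" "j < n" for i j
    using word_eval_closed[OF assms(1) s ascending_in_words] that by blast
  note square = W_relations_square[OF assms(2)]
  have p_Cons: "?p s i j = s i \<otimes> ?p s (Suc i) j" if "i \<le> j" for s i j
    using that by (simp add: ascending_Cons)
  have tail: "?p (bar_gen G s) i j = ?p s i j" if "3 \<le> i" for i j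
  proof (rule word_eval_cong)
    show "ascending i j \<in> words {3..}" using that by (auto simp: ascending_def words_def)
  qed (auto simp: bar_gen_def)
  \<comment> \<open>The case \<open>j = 2\<close> is included, where the remaining word from 3 is
    empty: products from 1 to 2 rely on it.\<close>
  have two: "?p (bar_gen G s) 2 j = s 1 \<otimes> (s 1 \<otimes> ?p s 2 j)" if j: "2 \<le> j" "j < n" for j
  proof -
    have "?p (bar_gen G s) 2 j = (s 1 \<otimes> s 1 \<otimes> s 2) \<otimes> ?p s 3 j"
      using p_Cons[of 2 j "bar_gen G s"] tail[of 3 j] j closed[of 1]
      by (simp add: bar_gen_def numeral_eq_Suc)
    then show ?thesis
      using p_Cons[of 2 j s] j closed[of 1] closed[of 2] p_closed[of 3 j]
      by (simp add: m_assoc numeral_eq_Suc)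
  qed
  have "?p (bar_gen G s) i j \<otimes> ?p (bar_gen G s) i j = \<one>" if ij: "1 \<le> i" "i < j" "j < n" for i j
  proof -
    consider "i = 1" | "i = 2" | "3 \<le> i" using ij(1) by linarith
    then show ?thesis
    proof cases
      case 1
      have in_G: "s 1 \<in> carrier G" "?p s 2 j \<in> carrier G" using closed p_closed ij by auto
      have "?p (bar_gen G s) 1 j = inv (s 1) \<otimes> (s 1 \<otimes> (s 1 \<otimes> ?p s 2 j))"
        using p_Cons[of 1 j "bar_gen G s"] two[of j] 1 ij by (simp add: bar_gen_def numeral_2_eq_2)
      also have "\<dots> = s 1 \<otimes> ?p s 2 j"
        using in_G by (simp only: m_assoc[symmetric] m_closed inv_closed l_inv l_one)
      also have "\<dots> = ?p s 1 j"
        using p_Cons[of 1 j s] 1 ij by (simp add: numeral_2_eq_2)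
      finally show ?thesis using square[OF ij] 1 by simp
    next
      case 2
      define a where "a = s 1"
      define b where "b = ?p s 2 j"
      have ab: "a \<in> carrier G" "b \<in> carrier G"
        using closed p_closed ij 2 by (auto simp: a_def b_def)
      have "?p s 1 j = a \<otimes> b"
        using p_Cons[of 1 j s] ij by (simp add: a_def b_def numeral_2_eq_2)
      then have abab: "(a \<otimes> b) \<otimes> (a \<otimes> b) = \<one>" using square[of 1 j] ij by simp
      have "b \<otimes> b = \<one>" using square[OF ij] 2 by (simp add: b_def)
      then have inv_b: "inv b = b" using ab inv_equality by blast
      have "a \<otimes> b \<otimes> a = inv b"
        using abab ab inv_equality[of "a \<otimes> b \<otimes> a" b] by (simp add: m_assoc)
      then have aba: "a \<otimes> (b \<otimes> a) = b" using inv_b ab by (simp add: m_assoc)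
      have "(a \<otimes> (a \<otimes> b)) \<otimes> (a \<otimes> (a \<otimes> b)) = a \<otimes> ((a \<otimes> (b \<otimes> a)) \<otimes> (a \<otimes> b))"
        using ab by (simp add: m_assoc)
      also have "\<dots> = (a \<otimes> b) \<otimes> (a \<otimes> b)"
        unfolding aba using ab by (simp add: m_assoc)
      finally show ?thesis using abab two[of j] 2 ij by (simp add: a_def b_def)
    next
      case 3
      then show ?thesis using tail square[OF ij] by simp
    qed
  qed
  moreover have "bar_gen G s ` {1..<n} \<subseteq> carrier G"
  proof safe
    fix i assume "i \<in> {1..<n}"
    then show "bar_gen G s i \<in> carrier G"
      using closed[of i] closed[of 1] by (auto simp: bar_gen_def)
  qed
  ultimately show ?thesis unfolding W_relations_def by blast
qed

lemma W_bar_hom: "W_bar n \<in> hom (W_plus n) (W_plus n)"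
  unfolding W_bar_eq
  by (intro W_hom_hom group_W_plus W_relations_bar_gen W_relations_W_gen)

lemma W_bar_gen: "i \<in> {1..<n} \<Longrightarrow> W_bar n (W_gen n i) = bar_gen (W_plus n) (W_gen n) i"
  unfolding W_bar_eq
  by (intro W_hom_gen group_W_plus W_relations_bar_gen W_relations_W_gen)

text \<open>\<open>bar_gen\<close> is a formula in the group operations, so homomorphisms preserve
  it. This carries bar from \<open>W_plus\<close> over to the automorphism group of a regular
  polytope.\<close>

lemma hom_bar_gen:
  assumes "group G" "group H" "h \<in> hom G H" "s ` {1..<n} \<subseteq> carrier G" "i \<in> {1..<n}"
  shows "h (bar_gen G s i) = bar_gen H (h \<circ> s) i"
proof -
  interpret group_hom G H h using assms by (simp add: group_hom_def group_hom_axioms_def)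
  have "s j \<in> carrier G" if "1 \<le> j" "j < n" for j using that assms(4) by auto
  then show ?thesis using assms(5) by (auto simp: bar_gen_def hom_nat_pow)
qed

text \<open>It suffices to look at generators. Only the second needs a calculation: applying bar to
  the square of the first times the second gives the inverse square, the square and the second
  generator, in this order.\<close>

lemma W_bar_W_bar:
  assumes "x \<in> carrier (W_plus n)"
  shows "W_bar n (W_bar n x) = x"
proof -
  interpret W: group "W_plus n" by (rule group_W_plus)
  have "(W_bar n \<circ> W_bar n) x = id x"
  proof (rule W_plus_hom_eqI[OF group_W_plus _ _ _ assms])
    show "W_bar n \<circ> W_bar n \<in> hom (W_plus n) (W_plus n)"
      using W_bar_hom Group.hom_compose by blast
    show "id \<in> hom (W_plus n) (W_plus n)" by (simp add: hom_def)
    fix i assume i: "i \<in> {1..<n}"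
    have gens: "W_gen n ` {1..<n} \<subseteq> carrier (W_plus n)" using W_gen_closed by auto
    have "(W_bar n \<circ> W_bar n) (W_gen n i) = bar_gen (W_plus n) (W_bar n \<circ> W_gen n) i"
      using hom_bar_gen[OF group_W_plus group_W_plus W_bar_hom gens i] W_bar_gen[OF i] by simp
    also have "\<dots> = W_gen n i"
    proof (cases "i = 2")
      case True
      then have "W_gen n 1 \<in> carrier (W_plus n)" "W_gen n 2 \<in> carrier (W_plus n)"
        using i W_gen_closed by auto
      then show ?thesis using True i W_bar_gen[of 1 n] W_bar_gen[of 2 n]
        by (simp add: bar_gen_def W.m_assoc[symmetric] numeral_2_eq_2 W.nat_pow_inv)
          (simp add: W.m_assoc)
    qed (use i W_gen_closed W_bar_gen in \<open>auto simp: bar_gen_def\<close>)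
    finally show "(W_bar n \<circ> W_bar n) (W_gen n i) = id (W_gen n i)" by simp
  qed
  then show ?thesis by simp
qed

section \<open>Flags of finite polytopes\<close>

text \<open>Finiteness of the face set makes the maximum in \<open>face_rank\<close> a maximum of a
  finite set and lets every chain be extended to a flag.\<close>

locale finite_polytope =
  fixes n :: nat and r :: "'a rel"
  assumes finite_Field: "finite (Field r)" and polytope: "abstract_polytope n r"
begin

lemma order_refl: "x \<in> Field r \<Longrightarrow> (x, x) \<in> r"
  using polytope
  by (auto simp: abstract_polytope_def partial_order_on_def preorder_on_def refl_on_def)

lemma order_trans: "(x, y) \<in> r \<Longrightarrow> (y, z) \<in> r \<Longrightarrow> (x, z) \<in> r"
  using polytope
  by (auto simp: abstract_polytope_def partial_order_on_def preorder_on_def dest: transD)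

lemma order_antisym: "(x, y) \<in> r \<Longrightarrow> (y, x) \<in> r \<Longrightarrow> x = y"
  using polytope
  by (auto simp: abstract_polytope_def partial_order_on_def dest: antisymD)

lemma card_flag: "C \<in> flags r \<Longrightarrow> card C = n + 2"
  using polytope by (auto simp: abstract_polytope_def)

lemma chain_subset: "C \<in> Chains r \<Longrightarrow> C \<subseteq> Field r"
  by (auto simp: Chains_def Field_def)

lemma chain_finite: "C \<in> Chains r \<Longrightarrow> finite C"
  using chain_subset finite_Field finite_subset by blast

lemma flag_chain: "C \<in> flags r \<Longrightarrow> C \<in> Chains r"
  by (simp add: flags_def)

lemma flag_subset: "C \<in> flags r \<Longrightarrow> C \<subseteq> Field r"
  using chain_subset flag_chain by blast

lemma flag_finite: "C \<in> flags r \<Longrightarrow> finite C"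
  using chain_finite flag_chain by blast

lemma chainD: "C \<in> Chains r \<Longrightarrow> x \<in> C \<Longrightarrow> y \<in> C \<Longrightarrow> (x, y) \<in> r \<or> (y, x) \<in> r"
  by (auto simp: Chains_def)

lemma chain_extends_to_flag:
  assumes "C \<in> Chains r"
  obtains D where "D \<in> flags r" "C \<subseteq> D"
proof -
  have "finite (Chains r)"
    by (rule finite_subset[of _ "Pow (Field r)"]) (use chain_subset finite_Field in auto)
  from finite_has_maximal2[OF this assms] obtain D
    where "D \<in> Chains r" "C \<subseteq> D" "\<forall>E\<in>Chains r. D \<subseteq> E \<longrightarrow> D = E"
    by blast
  then show thesis
    using that[of D] by (auto simp: flags_def)
qed

text \<open>A flag containing \<open>C\<close> has \<open>n + 2\<close> elements as well, so it is
  \<open>C\<close>. This recognises the flags obtained by exchanging a face or by applying an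
  automorphism.\<close>

lemma flagI:
  assumes "C \<in> Chains r" "card C = n + 2"
  shows "C \<in> flags r"
proof -
  obtain D where D: "D \<in> flags r" "C \<subseteq> D"
    using chain_extends_to_flag[OF assms(1)] .
  then have "C = D"
    using card_subset_eq[of D C] flag_finite card_flag assms(2) by simp
  with D show ?thesis by simp
qed

lemma face_in_flag:
  assumes "x \<in> Field r"
  obtains C where "C \<in> flags r" "x \<in> C"
proof -
  have "{x} \<in> Chains r" using order_refl[OF assms] by (auto simp: Chains_def)
  then show thesis using chain_extends_to_flag that by blast
qed

text \<open>Rank is the position in any flag through \<open>F\<close>. Let \<open>B\<close> be the
  part of the flag up to \<open>F\<close> and \<open>A\<close> the part above. Replacing
  \<open>B\<close> by another chain \<open>D\<close> below \<open>F\<close> leaves a chain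
  \<open>D \<union> A\<close>, which lies in a flag with \<open>n + 2\<close> elements; hence
  \<open>D\<close> is no larger than \<open>B\<close>.\<close>

lemma face_rank_flag:
  assumes "C \<in> flags r" "F \<in> C"
  shows "face_rank r F = int (card {G \<in> C. (G, F) \<in> r}) - 2"
proof -
  define B where "B = {G \<in> C. (G, F) \<in> r}"
  define A where "A = {G \<in> C. (F, G) \<in> r \<and> G \<noteq> F}"
  let ?S = "{card D |D. D \<in> Chains r \<and> D \<subseteq> {G. (G, F) \<in> r}}"
  have C: "C \<in> Chains r" "finite C" "C = B \<union> A" "B \<inter> A = {}"
    using assms flag_chain flag_finite chainD[OF flag_chain[OF assms(1)]] order_antisym
    by (auto simp: A_def B_def)
  then have card: "card B + card A = n + 2"
    using card_flag[OF assms(1)] card_Un_disjoint[of B A] by simp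
  have "Max ?S = card B"
  proof (rule Max_eqI)
    show "finite ?S"
      by (rule finite_subset[of _ "card ` Pow (Field r)"]) (use finite_Field chain_subset in auto)
    show "card B \<in> ?S"
      using C(1) by (auto simp: B_def Chains_def)
    fix k assume "k \<in> ?S"
    then obtain D where D: "k = card D" "D \<in> Chains r" "D \<subseteq> {G. (G, F) \<in> r}" by auto
    have "D \<union> A \<in> Chains r"
      using D C(1) order_trans unfolding Chains_def A_def by blast
    then obtain E where E: "E \<in> flags r" "D \<union> A \<subseteq> E" using chain_extends_to_flag by blast
    have "D \<inter> A = {}" using D(3) order_antisym by (auto simp: A_def)
    moreover have "finite D" "finite A" using chain_finite D(2) C by auto
    ultimately have "card D + card A = card (D \<union> A)" by (simp add: card_Un_disjoint)
    also have "\<dots> \<le> n + 2" using E card_flag card_mono[OF flag_finite] by metis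
    finally show "k \<le> card B" using card D(1) by simp
  qed
  then show ?thesis by (simp add: face_rank_def B_def)
qed

text \<open>Comparable faces lie in a common flag, and there the faces below the smaller one form a
  proper subset of those below the larger one.\<close>

lemma face_rank_strict_mono:
  assumes "(F, G) \<in> r" "F \<noteq> G"
  shows "face_rank r F < face_rank r G"
proof -
  have "F \<in> Field r" "G \<in> Field r" using assms by (auto simp: Field_def)
  then have "{F, G} \<in> Chains r" using assms order_refl by (auto simp: Chains_def)
  then obtain C where C: "C \<in> flags r" "{F, G} \<subseteq> C" using chain_extends_to_flag by blast
  have "{H \<in> C. (H, F) \<in> r} \<subset> {H \<in> C. (H, G) \<in> r}"
    using assms C order_trans order_antisym order_refl[OF \<open>G \<in> Field r\<close>] by blast
  then have "card {H \<in> C. (H, F) \<in> r} < card {H \<in> C. (H, G) \<in> r}"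
    using flag_finite[OF C(1)] by (intro psubset_card_mono) auto
  then show ?thesis using C by (simp add: face_rank_flag)
qed

lemma inj_on_face_rank:
  assumes "C \<in> flags r"
  shows "inj_on (face_rank r) C"
proof (rule inj_onI)
  fix F G assume "F \<in> C" "G \<in> C" "face_rank r F = face_rank r G"
  then show "F = G"
    using chainD[OF flag_chain[OF assms]] face_rank_strict_mono by (metis less_irrefl)
qed

text \<open>By injectivity a flag has \<open>n + 2\<close> ranks, all within an interval of
  \<open>n + 2\<close> integers, so every rank occurs exactly once.\<close>

lemma face_rank_image:
  assumes "C \<in> flags r"
  shows "face_rank r ` C = {- 1..int n}"
proof (rule card_subset_eq)
  show "face_rank r ` C \<subseteq> {- 1..int n}"
  proof safe
    fix F assume F: "F \<in> C"
    have "F \<in> {G \<in> C. (G, F) \<in> r}" using F order_refl flag_subset[OF assms] by auto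
    then have "card {G \<in> C. (G, F) \<in> r} \<noteq> 0" using flag_finite[OF assms] by auto
    moreover have "card {G \<in> C. (G, F) \<in> r} \<le> n + 2"
      using card_mono[OF flag_finite[OF assms], of "{G \<in> C. (G, F) \<in> r}"] card_flag[OF assms]
      by auto
    ultimately show "face_rank r F \<in> {- 1..int n}" using face_rank_flag[OF assms F] by auto
  qed
  show "card (face_rank r ` C) = card {- 1..int n}"
    using card_image[OF inj_on_face_rank[OF assms]] card_flag[OF assms] by simp
qed simp

section \<open>Flags as families of faces indexed by rank\<close>

definition face :: "'a set \<Rightarrow> int \<Rightarrow> 'a" where
  "face C k = inv_into C (face_rank r) k"

lemma face_in: "C \<in> flags r \<Longrightarrow> - 1 \<le> k \<Longrightarrow> k \<le> int n \<Longrightarrow> face C k \<in> C"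
  unfolding face_def by (rule inv_into_into) (simp add: face_rank_image)

lemma face_rank_face:
  "C \<in> flags r \<Longrightarrow> - 1 \<le> k \<Longrightarrow> k \<le> int n \<Longrightarrow> face_rank r (face C k) = k"
  unfolding face_def by (rule f_inv_into_f) (simp add: face_rank_image)

lemma face_face_rank: "C \<in> flags r \<Longrightarrow> F \<in> C \<Longrightarrow> face C (face_rank r F) = F"
  unfolding face_def by (rule inv_into_f_f[OF inj_on_face_rank])

lemma face_eqI: "C \<in> flags r \<Longrightarrow> F \<in> C \<Longrightarrow> face_rank r F = k \<Longrightarrow> face C k = F"
  using face_face_rank by blast

lemma face_rank_bounds:
  assumes "C \<in> flags r" "F \<in> C"
  shows "- 1 \<le> face_rank r F" "face_rank r F \<le> int n"
proof -
  have "face_rank r F \<in> {- 1..int n}" using assms face_rank_image by blast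
  then show "- 1 \<le> face_rank r F" "face_rank r F \<le> int n" by auto
qed

lemma flag_eqI:
  assumes "C \<in> flags r" "D \<in> flags r"
    and "\<And>k. - 1 \<le> k \<Longrightarrow> k \<le> int n \<Longrightarrow> face C k = face D k"
  shows "C = D"
proof -
  have "C \<subseteq> D"
    using assms face_face_rank face_in face_rank_bounds by (metis subsetI)
  then show ?thesis
    using card_subset_eq[OF flag_finite[OF assms(2)]] card_flag assms by metis
qed

lemma face_mono:
  assumes "C \<in> flags r" "- 1 \<le> j" "j \<le> k" "k \<le> int n"
  shows "(face C j, face C k) \<in> r"
proof -
  have "face C j \<in> C" "face C k \<in> C" using assms face_in by auto
  then have "(face C j, face C k) \<in> r \<or> (face C k, face C j) \<in> r"
    using chainD[OF flag_chain[OF assms(1)]] by blast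
  moreover have "face C j = face C k" if "(face C k, face C j) \<in> r"
    using face_rank_strict_mono[OF that] face_rank_face[OF assms(1)] assms by force
  moreover have "(face C k, face C k) \<in> r"
    using order_refl flag_subset[OF assms(1)] \<open>face C k \<in> C\<close> by auto
  ultimately show ?thesis by metis
qed

text \<open>Maximality forces the least face into every flag, and it has rank -1 because nothing
  else lies below it. Together with its dual for the greatest face this shows that adjacent flags
  can differ only in a rank from 0 to \<open>n - 1\<close>.\<close>

lemma face_bottom:
  assumes "C \<in> flags r" "D \<in> flags r"
  shows "face C (- 1) = face D (- 1)"
proof -
  obtain z where z: "z \<in> Field r" "\<And>G. G \<in> Field r \<Longrightarrow> (z, G) \<in> r"
    using polytope by (auto simp: abstract_polytope_def)
  have "face E (- 1) = z" if E: "E \<in> flags r" for E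
  proof -
    have "insert z E \<in> Chains r"
      using flag_chain[OF E] flag_subset[OF E] z by (auto simp: Chains_def)
    then have "z \<in> E" using E by (auto simp: flags_def)
    moreover have "{G \<in> E. (G, z) \<in> r} = {z}"
      using \<open>z \<in> E\<close> z order_antisym flag_subset[OF E] by auto
    ultimately show ?thesis
      using face_rank_flag[OF E \<open>z \<in> E\<close>] by (intro face_eqI[OF E]) auto
  qed
  then show ?thesis using assms by simp
qed

lemma face_top:
  assumes "C \<in> flags r" "D \<in> flags r"
  shows "face C (int n) = face D (int n)"
proof -
  obtain z where z: "z \<in> Field r" "\<And>G. G \<in> Field r \<Longrightarrow> (G, z) \<in> r"
    using polytope by (auto simp: abstract_polytope_def)
  have "face E (int n) = z" if E: "E \<in> flags r" for E
  proof -
    have "insert z E \<in> Chains r"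
      using flag_chain[OF E] flag_subset[OF E] z by (auto simp: Chains_def)
    then have "z \<in> E" using E by (auto simp: flags_def)
    moreover have "{G \<in> E. (G, z) \<in> r} = E" using z flag_subset[OF E] by auto
    ultimately show ?thesis
      using face_rank_flag[OF E \<open>z \<in> E\<close>] card_flag[OF E] by (intro face_eqI[OF E]) auto
  qed
  then show ?thesis using assms by simp
qed

text \<open>Translates the condition in \<open>adj_flag\<close> into the language of faces indexed
  by rank.\<close>

lemma same_off_rank_iff:
  assumes "C \<in> flags r" "D \<in> flags r"
  shows "{F \<in> D. face_rank r F \<noteq> i} = {F \<in> C. face_rank r F \<noteq> i} \<longleftrightarrow>
    (\<forall>k. - 1 \<le> k \<longrightarrow> k \<le> int n \<longrightarrow> k \<noteq> i \<longrightarrow> face D k = face C k)" (is "?L \<longleftrightarrow> ?R")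
proof
  assume L: ?L
  show ?R
  proof (intro allI impI)
    fix k assume k: "- 1 \<le> k" "k \<le> int n" "k \<noteq> i"
    have "face D k \<in> {F \<in> D. face_rank r F \<noteq> i}"
      using face_in[OF assms(2)] face_rank_face[OF assms(2)] k by auto
    then have "face D k \<in> C" using L by blast
    then show "face D k = face C k"
      using face_eqI[OF assms(1)] face_rank_face[OF assms(2)] k by metis
  qed
next
  have *: "{F \<in> D. face_rank r F \<noteq> i} \<subseteq> {F \<in> C. face_rank r F \<noteq> i}"
    if "C \<in> flags r" "D \<in> flags r"
      "\<forall>k. - 1 \<le> k \<longrightarrow> k \<le> int n \<longrightarrow> k \<noteq> i \<longrightarrow> face D k = face C k" for C D
    using that face_face_rank face_in face_rank_bounds by (smt (verit) mem_Collect_eq subsetI)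
  assume ?R
  then show ?L using *[of C D] *[of D C] assms by (intro subset_antisym) auto
qed

section \<open>The diamond condition and adjacent flags\<close>

lemma card_between:
  assumes "C \<in> flags r" "i < n"
  shows "card {H. (face C (int i - 1), H) \<in> r \<and> (H, face C (int i + 1)) \<in> r \<and>
    H \<noteq> face C (int i - 1) \<and> H \<noteq> face C (int i + 1)} = 2"
proof -
  have "(face C (int i - 1), face C (int i + 1)) \<in> r"
    using assms by (intro face_mono) auto
  moreover have "face_rank r (face C (int i + 1)) = face_rank r (face C (int i - 1)) + 2"
    using assms by (simp add: face_rank_face)
  ultimately show ?thesis using polytope by (auto simp: abstract_polytope_def)
qed

lemma face_between:
  assumes "C \<in> flags r" "i < n"
  shows "face C (int i) \<in> {H. (face C (int i - 1), H) \<in> r \<and> (H, face C (int i + 1)) \<in> r \<and>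
    H \<noteq> face C (int i - 1) \<and> H \<noteq> face C (int i + 1)}"
proof -
  have "face_rank r (face C (int i)) = int i" "face_rank r (face C (int i - 1)) = int i - 1"
    "face_rank r (face C (int i + 1)) = int i + 1"
    using assms by (simp_all add: face_rank_face)
  moreover have "(face C (int i - 1), face C (int i)) \<in> r" "(face C (int i), face C (int i + 1)) \<in> r"
    using assms by (auto intro: face_mono)
  ultimately show ?thesis by auto
qed

text \<open>All three faces lie in the two-element set strictly between the neighbouring faces of
  \<open>C\<close>; those of \<open>D\<close> and \<open>E\<close> avoid that of \<open>C\<close>,
  so both are the remaining element.\<close>

lemma diamond:
  assumes "C \<in> flags r" "D \<in> flags r" "E \<in> flags r" "i < n"
    and "face D (int i - 1) = face C (int i - 1)" "face D (int i + 1) = face C (int i + 1)"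
    and "face E (int i - 1) = face C (int i - 1)" "face E (int i + 1) = face C (int i + 1)"
    and "face D (int i) \<noteq> face C (int i)" "face E (int i) \<noteq> face C (int i)"
  shows "face D (int i) = face E (int i)"
proof -
  let ?S = "{H. (face C (int i - 1), H) \<in> r \<and> (H, face C (int i + 1)) \<in> r \<and>
    H \<noteq> face C (int i - 1) \<and> H \<noteq> face C (int i + 1)}"
  have "card ?S = 2" using card_between assms by blast
  then obtain a b where ab: "?S = {a, b}" unfolding card_2_iff by blast
  have "face C (int i) \<in> ?S" "face D (int i) \<in> ?S" "face E (int i) \<in> ?S"
    using face_between[OF assms(1,4)] face_between[OF assms(2,4)] face_between[OF assms(3,4)]
    unfolding assms(5-8) .
  then show ?thesis using assms(9,10) unfolding ab by auto
qed

text \<open>The face of rank \<open>i\<close> is exchanged for the other element \<open>H\<close>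
  between its neighbours. The result is a chain of the same size, hence a flag.\<close>

lemma ex_adjacent:
  assumes C: "C \<in> flags r" and i: "i < n"
  obtains D where "D \<in> flags r" "face D (int i) \<noteq> face C (int i)"
    "\<And>k. - 1 \<le> k \<Longrightarrow> k \<le> int n \<Longrightarrow> k \<noteq> int i \<Longrightarrow> face D k = face C k"
proof -
  let ?S = "{H. (face C (int i - 1), H) \<in> r \<and> (H, face C (int i + 1)) \<in> r \<and>
    H \<noteq> face C (int i - 1) \<and> H \<noteq> face C (int i + 1)}"
  obtain H where H: "H \<in> ?S" "H \<noteq> face C (int i)"
    using card_between[OF assms] unfolding card_2_iff by (metis insertI1 insertI2)
  then have "face_rank r (face C (int i - 1)) < face_rank r H"
    "face_rank r H < face_rank r (face C (int i + 1))"
    using face_rank_strict_mono by auto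
  then have rank_H: "face_rank r H = int i" using face_rank_face[OF C] i by auto
  have "H \<notin> C" using face_eqI[OF C] rank_H H(2) by blast
  \<comment> \<open>Every other face of \<open>C\<close> lies below the face of rank
    \<open>i - 1\<close> or above the face of rank \<open>i + 1\<close>, so transitivity through
    this neighbour compares it with \<open>H\<close>.\<close>
  have comparable: "(G, H) \<in> r \<or> (H, G) \<in> r" if G: "G \<in> C - {face C (int i)}" for G
  proof -
    have bounds: "- 1 \<le> face_rank r G" "face_rank r G \<le> int n" "face_rank r G \<noteq> int i"
      using G face_rank_bounds[OF C] face_face_rank[OF C] by force+
    then consider "face_rank r G \<le> int i - 1" | "int i + 1 \<le> face_rank r G" by linarith
    then show ?thesis
    proof cases
      case 1
      then have "(G, face C (int i - 1)) \<in> r"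
        using face_mono[OF C, of "face_rank r G" "int i - 1"] face_face_rank[OF C] G bounds i by auto
      then show ?thesis using H order_trans by blast
    next
      case 2
      then have "(face C (int i + 1), G) \<in> r"
        using face_mono[OF C, of "int i + 1" "face_rank r G"] face_face_rank[OF C] G bounds i by auto
      then show ?thesis using H order_trans by blast
    qed
  qed
  define D where "D = insert H (C - {face C (int i)})"
  have "H \<in> Field r" using H(1) by (auto simp: Field_def)
  then have "D \<in> Chains r"
    using comparable flag_chain[OF C] order_refl unfolding D_def Chains_def by blast
  moreover have "card D = n + 2"
    using card_flag[OF C] flag_finite[OF C] \<open>H \<notin> C\<close> face_in[OF C, of "int i"] i
    by (simp add: D_def card_Diff_singleton)
  ultimately have D: "D \<in> flags r" by (rule flagI)
  show thesis
  proof (rule that[OF D])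
    have "face D (int i) = H" using face_eqI[OF D] rank_H by (simp add: D_def)
    then show "face D (int i) \<noteq> face C (int i)" using H(2) by simp
    fix k assume k: "- 1 \<le> k" "k \<le> int n" "k \<noteq> int i"
    then have "face C k \<noteq> face C (int i)"
      using face_rank_face[OF C, of k] face_rank_face[OF C, of "int i"] i by auto
    then have "face C k \<in> D" using face_in[OF C] k by (simp add: D_def)
    then show "face D k = face C k" using face_eqI[OF D] face_rank_face[OF C] k by simp
  qed
qed

text \<open>The uniqueness behind the description in \<open>adj_flag\<close>: a competitor agreeing
  with \<open>C\<close> off rank \<open>i\<close> must differ from it in rank \<open>i\<close>, and
  there \<open>diamond\<close> leaves a single choice.\<close>

lemma adj_flag_eqI:
  assumes "C \<in> flags r" "i < n" "D \<in> flags r" "D \<noteq> C"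
    and "\<And>k. - 1 \<le> k \<Longrightarrow> k \<le> int n \<Longrightarrow> k \<noteq> int i \<Longrightarrow> face D k = face C k"
  shows "adj_flag r i C = D"
  unfolding adj_flag_def
proof (rule the_equality)
  show "D \<in> flags r \<and> D \<noteq> C \<and>
    {F \<in> D. face_rank r F \<noteq> int i} = {F \<in> C. face_rank r F \<noteq> int i}"
    using assms same_off_rank_iff by auto
next
  fix E
  assume E: "E \<in> flags r \<and> E \<noteq> C \<and>
    {F \<in> E. face_rank r F \<noteq> int i} = {F \<in> C. face_rank r F \<noteq> int i}"
  then have faces: "\<And>k. - 1 \<le> k \<Longrightarrow> k \<le> int n \<Longrightarrow> k \<noteq> int i \<Longrightarrow> face E k = face C k"
    using same_off_rank_iff assms(1) by blast
  have differ: "face B (int i) \<noteq> face C (int i)"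
    if "B \<in> flags r" "B \<noteq> C"
      "\<And>k. - 1 \<le> k \<Longrightarrow> k \<le> int n \<Longrightarrow> k \<noteq> int i \<Longrightarrow> face B k = face C k" for B
    using that flag_eqI[of B C] assms(1) by metis
  have "face E (int i) = face D (int i)"
    by (rule diamond[of C]) (use assms E faces differ in auto)
  then show "E = D"
    using flag_eqI[of E D] E assms faces by metis
qed

lemma
  assumes "C \<in> flags r" "i < n"
  shows adj_flag_in_flags: "adj_flag r i C \<in> flags r"
    and face_adj_flag_differs: "face (adj_flag r i C) (int i) \<noteq> face C (int i)"
    and face_adj_flag: "\<And>k. - 1 \<le> k \<Longrightarrow> k \<le> int n \<Longrightarrow> k \<noteq> int i \<Longrightarrow>
      face (adj_flag r i C) k = face C k"
proof -
  obtain D where D: "D \<in> flags r" "face D (int i) \<noteq> face C (int i)"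
    "\<And>k. - 1 \<le> k \<Longrightarrow> k \<le> int n \<Longrightarrow> k \<noteq> int i \<Longrightarrow> face D k = face C k"
    using ex_adjacent[OF assms] by metis
  have "adj_flag r i C = D" using adj_flag_eqI[OF assms D(1)] D by blast
  then show "adj_flag r i C \<in> flags r" "face (adj_flag r i C) (int i) \<noteq> face C (int i)"
    "\<And>k. - 1 \<le> k \<Longrightarrow> k \<le> int n \<Longrightarrow> k \<noteq> int i \<Longrightarrow> face (adj_flag r i C) k = face C k"
    using D by auto
qed

lemma adj_flag_neq: "C \<in> flags r \<Longrightarrow> i < n \<Longrightarrow> adj_flag r i C \<noteq> C"
  using face_adj_flag_differs by metis

lemma adj_flag_involution:
  assumes "C \<in> flags r" "i < n"
  shows "adj_flag r i (adj_flag r i C) = C"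
  by (rule adj_flag_eqI)
    (use assms adj_flag_in_flags[OF assms] adj_flag_neq[OF assms, symmetric] in
      \<open>simp_all add: face_adj_flag\<close>)

text \<open>The exchange is local: by \<open>diamond\<close> the new face is determined by the faces
  of ranks \<open>i - 1\<close>, \<open>i\<close> and \<open>i + 1\<close>.\<close>

lemma face_adj_flag_cong:
  assumes "C \<in> flags r" "D \<in> flags r" "i < n"
    and "face D (int i - 1) = face C (int i - 1)" "face D (int i) = face C (int i)"
      "face D (int i + 1) = face C (int i + 1)"
  shows "face (adj_flag r i D) (int i) = face (adj_flag r i C) (int i)"
proof (rule diamond[of C])
  show "face (adj_flag r i D) (int i) \<noteq> face C (int i)"
    using face_adj_flag_differs[OF assms(2,3)] assms(5) by simp
  show "face (adj_flag r i C) (int i) \<noteq> face C (int i)"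
    using face_adj_flag_differs[OF assms(1,3)] .
qed (use assms(1-3) adj_flag_in_flags assms(4,6) in \<open>simp_all add: face_adj_flag\<close>)

text \<open>The gap of at least two keeps each of the two ranks outside the three ranks on which the
  exchange at the other depends, so neither exchange affects the other.\<close>

lemma adj_flag_commute:
  assumes C: "C \<in> flags r" and ij: "i < n" "j < n" "i + 2 \<le> j"
  shows "adj_flag r i (adj_flag r j C) = adj_flag r j (adj_flag r i C)"
proof (rule flag_eqI)
  note flags = C adj_flag_in_flags[OF C ij(1)] adj_flag_in_flags[OF C ij(2)]
  show "adj_flag r i (adj_flag r j C) \<in> flags r" "adj_flag r j (adj_flag r i C) \<in> flags r"
    using flags adj_flag_in_flags ij by auto
  have i: "face (adj_flag r i (adj_flag r j C)) (int i) = face (adj_flag r i C) (int i)"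
    by (rule face_adj_flag_cong) (use flags ij in \<open>simp_all add: face_adj_flag\<close>)
  have j: "face (adj_flag r j (adj_flag r i C)) (int j) = face (adj_flag r j C) (int j)"
    by (rule face_adj_flag_cong) (use flags ij in \<open>simp_all add: face_adj_flag\<close>)
  fix k assume k: "- 1 \<le> k" "k \<le> int n"
  consider "k = int i" | "k = int j" | "k \<noteq> int i" "k \<noteq> int j" by blast
  then show "face (adj_flag r i (adj_flag r j C)) k = face (adj_flag r j (adj_flag r i C)) k"
  proof cases
    case 1
    then show ?thesis using i k face_adj_flag[OF flags(2) ij(2), of k] ij(3) by simp
  next
    case 2
    then show ?thesis using j k face_adj_flag[OF flags(3) ij(1), of k] ij(3) by simp
  next
    case 3
    then show ?thesis using k flags ij by (simp add: face_adj_flag)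
  qed
qed

text \<open>The ranks of \<open>C \<inter> D\<close> are all ranks but that of \<open>F\<close>, and
  also all ranks but that of \<open>G\<close>, so the exchanged faces have equal rank. It is neither
  -1 nor \<open>n\<close>, because the extreme faces belong to all flags.\<close>

lemma adjacent_flagsE:
  assumes "adjacent_flags r C D"
  obtains i where "i < n" "D = adj_flag r i C"
proof -
  have C: "C \<in> flags r" and D: "D \<in> flags r"
    using assms by (auto simp: adjacent_flags_def)
  obtain F G where FG: "C - D = {F}" "D - C = {G}"
    using assms by (auto simp: adjacent_flags_def card_1_singleton_iff)
  have "face_rank r ` (C \<inter> D) = {- 1..int n} - {face_rank r F}"
    using inj_on_image_set_diff[OF inj_on_face_rank[OF C], of C "{F}"] face_rank_image[OF C] FG(1)
    by (metis Diff_Diff_Int Diff_subset image_empty image_insert)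
  moreover have "face_rank r ` (C \<inter> D) = {- 1..int n} - {face_rank r G}"
    using inj_on_image_set_diff[OF inj_on_face_rank[OF D], of D "{G}"] face_rank_image[OF D] FG(2)
    by (metis Diff_Diff_Int Diff_subset Int_commute image_empty image_insert)
  moreover have FG_in: "F \<in> C" "F \<notin> D" "G \<in> D" "G \<notin> C" using FG by blast+
  moreover have "face_rank r F \<in> {- 1..int n}" "face_rank r G \<in> {- 1..int n}"
    using face_rank_image[OF C] face_rank_image[OF D] FG_in by blast+
  ultimately have rank: "face_rank r F = face_rank r G" by blast
  have faces: "face D k = face C k" if k: "- 1 \<le> k" "k \<le> int n" "k \<noteq> face_rank r F" for k
  proof -
    have "face C k \<in> C" "face C k \<noteq> F"
      using face_in[OF C] face_rank_face[OF C] k by auto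
    then have "face C k \<in> D" using FG by blast
    then show ?thesis using face_eqI[OF D] face_rank_face[OF C] k by simp
  qed
  have "face D (face_rank r F) \<noteq> face C (face_rank r F)"
    using face_face_rank FG_in C D rank by metis
  then have "face_rank r F \<noteq> - 1" "face_rank r F \<noteq> int n"
    using face_bottom face_top C D by metis+
  then have *: "0 \<le> face_rank r F" "face_rank r F < int n" using face_rank_bounds[OF C FG_in(1)] by auto
  show thesis
  proof (rule that)
    show "nat (face_rank r F) < n" using * by auto
    show "D = adj_flag r (nat (face_rank r F)) C"
      using * D faces FG_in by (intro adj_flag_eqI[OF C, symmetric]) auto
  qed
qed

lemma adjacent_adj_flag:
  assumes C: "C \<in> flags r" and i: "i < n"
  shows "adjacent_flags r C (adj_flag r i C)"
proof -
  \<comment> \<open>Proved for arbitrary \<open>A\<close> and \<open>B\<close>, so that exchanging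
    their roles yields both set differences.\<close>
  have "A - B = {face A (int i)}"
    if A: "A \<in> flags r" and B: "B \<in> flags r" and differ: "face B (int i) \<noteq> face A (int i)"
      and faces: "\<And>k. - 1 \<le> k \<Longrightarrow> k \<le> int n \<Longrightarrow> k \<noteq> int i \<Longrightarrow> face B k = face A k" for A B
  proof (intro subset_antisym subsetI)
    fix F assume F: "F \<in> A - B"
    have "face_rank r F = int i"
    proof (rule ccontr)
      assume "face_rank r F \<noteq> int i"
      then have "face B (face_rank r F) = F"
        using F faces[OF face_rank_bounds[OF A]] face_face_rank[OF A, of F] by simp
      then show False using F face_in[OF B face_rank_bounds[OF A]] by force
    qed
    then show "F \<in> {face A (int i)}" using face_face_rank[OF A, of F] F by simp
  next
    fix F assume "F \<in> {face A (int i)}"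
    then have F: "F = face A (int i)" by simp
    then have "face_rank r F = int i" "F \<in> A" using face_rank_face[OF A] face_in[OF A] i by auto
    moreover have "F \<notin> B" using face_eqI[OF B, of F "int i"] differ F calculation(1) by metis
    ultimately show "F \<in> A - B" by simp
  qed
  note this[OF C adj_flag_in_flags[OF assms] face_adj_flag_differs[OF assms]]
    this[OF adj_flag_in_flags[OF assms] C face_adj_flag_differs[OF assms, symmetric]]
  then have "C - adj_flag r i C = {face C (int i)}"
    "adj_flag r i C - C = {face (adj_flag r i C) (int i)}"
    using face_adj_flag[OF assms] by simp_all
  then show ?thesis
    using C adj_flag_in_flags[OF assms] by (simp add: adjacent_flags_def)
qed

text \<open>Flag-connectedness as an induction principle: by \<open>adjacent_flagsE\<close> a path
  of adjacent flags is a sequence of \<open>adj_flag\<close> steps.\<close>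

lemma flag_connected_induct:
  assumes "C \<in> flags r" "D \<in> flags r" "P C"
    and step: "\<And>E i. E \<in> flags r \<Longrightarrow> i < n \<Longrightarrow> P E \<Longrightarrow> P (adj_flag r i E)"
  shows "P D"
proof -
  have "(C, D) \<in> {(A, B). adjacent_flags r A B \<and> C \<inter> D \<subseteq> A \<and> C \<inter> D \<subseteq> B}\<^sup>*"
    using polytope assms(1,2) by (auto simp: abstract_polytope_def)
  then show ?thesis
  proof (induction rule: rtrancl_induct)
    case base
    show ?case by fact
  next
    case (step E E')
    then have adjacent: "adjacent_flags r E E'" by simp
    then obtain i where "i < n" "E' = adj_flag r i E" by (rule adjacent_flagsE)
    then show ?case using assms(4) step.IH adjacent by (simp add: adjacent_flags_def)
  qed
qed

section \<open>Automorphisms and rotations\<close>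

abbreviation Aut :: "('a \<Rightarrow> 'a) monoid" where "Aut \<equiv> aut_group r"

lemma carrier_Aut:
  "f \<in> carrier Aut \<longleftrightarrow> f \<in> Bij (Field r) \<and>
    (\<forall>x\<in>Field r. \<forall>y\<in>Field r. (f x, f y) \<in> r \<longleftrightarrow> (x, y) \<in> r)"
  by (simp add: aut_group_def)

lemma Aut_in_Field: "f \<in> carrier Aut \<Longrightarrow> x \<in> Field r \<Longrightarrow> f x \<in> Field r"
  using Bij_imp_funcset by (fastforce simp: carrier_Aut)

lemma Aut_order_iff:
  "f \<in> carrier Aut \<Longrightarrow> x \<in> Field r \<Longrightarrow> y \<in> Field r \<Longrightarrow> (f x, f y) \<in> r \<longleftrightarrow> (x, y) \<in> r"
  by (simp add: carrier_Aut)

lemma inj_on_Aut: "f \<in> carrier Aut \<Longrightarrow> inj_on f (Field r)"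
  by (simp add: carrier_Aut Bij_def bij_betw_def)

lemma mult_Aut: "f \<in> carrier Aut \<Longrightarrow> g \<in> carrier Aut \<Longrightarrow> f \<otimes>\<^bsub>Aut\<^esub> g = compose (Field r) f g"
  unfolding carrier_Aut by (simp add: aut_group_def BijGroup_def)

lemma one_Aut: "\<one>\<^bsub>Aut\<^esub> = (\<lambda>x\<in>Field r. x)"
  by (simp add: aut_group_def BijGroup_def)

lemma group_Aut: "group Aut"
proof -
  interpret B: group "BijGroup (Field r)" by (rule group_BijGroup)
  have "subgroup (carrier Aut) (BijGroup (Field r))"
  proof (rule B.subgroupI)
    show "carrier Aut \<subseteq> carrier (BijGroup (Field r))"
      by (auto simp: carrier_Aut BijGroup_def)
    have "\<one>\<^bsub>Aut\<^esub> \<in> carrier Aut"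
      by (simp add: one_Aut carrier_Aut id_Bij)
    then show "carrier Aut \<noteq> {}" by blast
    fix f assume f: "f \<in> carrier Aut"
    then have bij: "f \<in> Bij (Field r)" by (simp add: carrier_Aut)
    have inv_in: "inv_into (Field r) f x \<in> Field r" and f_inv: "f (inv_into (Field r) f x) = x"
      if "x \<in> Field r" for x
      using that Bij_inv_into_mem[OF bij that] bij bij_betw_inv_into_right[of f "Field r" "Field r" x]
      by (simp_all add: Bij_def)
    have "(inv_into (Field r) f x, inv_into (Field r) f y) \<in> r \<longleftrightarrow> (x, y) \<in> r"
      if "x \<in> Field r" "y \<in> Field r" for x y
      using Aut_order_iff[OF f inv_in[OF that(1)] inv_in[OF that(2)]] f_inv that by simp
    then show "inv\<^bsub>BijGroup (Field r)\<^esub> f \<in> carrier Aut"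
      by (simp add: inv_BijGroup[OF bij] carrier_Aut restrict_inv_into_Bij[OF bij])
    fix g assume g: "g \<in> carrier Aut"
    then have bij': "g \<in> Bij (Field r)" by (simp add: carrier_Aut)
    have "f \<otimes>\<^bsub>BijGroup (Field r)\<^esub> g = compose (Field r) f g"
      using bij bij' by (simp add: BijGroup_def)
    moreover have "compose (Field r) f g \<in> carrier Aut"
      using f g bij bij' Aut_in_Field by (simp add: carrier_Aut compose_Bij compose_eq)
    ultimately show "f \<otimes>\<^bsub>BijGroup (Field r)\<^esub> g \<in> carrier Aut" by simp
  qed
  then have "group (BijGroup (Field r) \<lparr>carrier := carrier Aut\<rparr>)"
    by (rule B.subgroup_imp_group)
  then show ?thesis by (simp add: aut_group_def)
qed

sublocale Aut: group Aut
  by (rule group_Aut)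

lemma mult_Aut_image:
  assumes "f \<in> carrier Aut" "g \<in> carrier Aut" "C \<in> flags r"
  shows "(f \<otimes>\<^bsub>Aut\<^esub> g) ` C = f ` g ` C"
proof -
  have "(f \<otimes>\<^bsub>Aut\<^esub> g) x = f (g x)" if "x \<in> C" for x
    using that flag_subset[OF assms(3)] assms(1,2) by (simp add: mult_Aut compose_eq subset_iff)
  then show ?thesis by (simp add: image_image)
qed

lemma one_Aut_image:
  assumes "C \<in> flags r"
  shows "\<one>\<^bsub>Aut\<^esub> ` C = C"
proof -
  have "\<one>\<^bsub>Aut\<^esub> x = x" if "x \<in> C" for x
    using that flag_subset[OF assms] by (auto simp: one_Aut)
  then show ?thesis by simp
qed

lemma Aut_flag:
  assumes "f \<in> carrier Aut" "C \<in> flags r"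
  shows "f ` C \<in> flags r"
proof (rule flagI)
  show "f ` C \<in> Chains r"
    using chainD[OF flag_chain[OF assms(2)]] Aut_order_iff[OF assms(1)] flag_subset[OF assms(2)]
    unfolding Chains_def by blast
  show "card (f ` C) = n + 2"
    using card_image[OF inj_on_subset[OF inj_on_Aut[OF assms(1)] flag_subset[OF assms(2)]]]
      card_flag[OF assms(2)] by simp
qed

text \<open>Rank is the position in a flag, and an automorphism maps the part of a flag below
  \<open>x\<close> bijectively onto the part of the image flag below \<open>f x\<close>.\<close>

lemma face_rank_Aut:
  assumes f: "f \<in> carrier Aut" and x: "x \<in> Field r"
  shows "face_rank r (f x) = face_rank r x"
proof -
  obtain C where C: "C \<in> flags r" "x \<in> C" using face_in_flag[OF x] .
  have "{G \<in> f ` C. (G, f x) \<in> r} = f ` {G \<in> C. (G, x) \<in> r}"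
    using Aut_order_iff[OF f _ x] flag_subset[OF C(1)] by auto
  moreover have "inj_on f {G \<in> C. (G, x) \<in> r}"
    by (rule inj_on_subset[OF inj_on_Aut[OF f]]) (use flag_subset[OF C(1)] in auto)
  ultimately show ?thesis
    using face_rank_flag[OF C] face_rank_flag[OF Aut_flag[OF f C(1)], of "f x"] C(2)
    by (simp add: card_image)
qed

lemma face_Aut:
  assumes "f \<in> carrier Aut" "C \<in> flags r" "- 1 \<le> k" "k \<le> int n"
  shows "face (f ` C) k = f (face C k)"
proof (rule face_eqI[OF Aut_flag[OF assms(1,2)]])
  have "face C k \<in> C" using face_in assms by blast
  then show "f (face C k) \<in> f ` C" by blast
  show "face_rank r (f (face C k)) = k"
    using face_rank_Aut[OF assms(1)] flag_subset[OF assms(2)] \<open>face C k \<in> C\<close>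
      face_rank_face assms by auto
qed

lemma Aut_adj_flag:
  assumes f: "f \<in> carrier Aut" and C: "C \<in> flags r" and i: "i < n"
  shows "f ` adj_flag r i C = adj_flag r i (f ` C)"
proof (rule adj_flag_eqI[symmetric])
  note D = adj_flag_in_flags[OF C i]
  show "f ` C \<in> flags r" "f ` adj_flag r i C \<in> flags r" "i < n"
    using Aut_flag f C D i by auto
  show "f ` adj_flag r i C \<noteq> f ` C"
    using inj_on_image_eq_iff[OF inj_on_Aut[OF f] flag_subset[OF D] flag_subset[OF C]]
      adj_flag_neq[OF C i] by simp
  fix k assume "- 1 \<le> k" "k \<le> int n" "k \<noteq> int i"
  then show "face (f ` adj_flag r i C) k = face (f ` C) k"
    using face_Aut[OF f C] face_Aut[OF f D] face_adj_flag[OF C i] by simp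
qed

text \<open>The action on flags is free: being fixed spreads from \<open>C\<close> to all flags by
  connectedness, and a fixed flag is fixed face by face because ranks are preserved.\<close>

lemma Aut_fixing_flag:
  assumes f: "f \<in> carrier Aut" and C: "C \<in> flags r" and fixes_C: "f ` C = C"
  shows "f = \<one>\<^bsub>Aut\<^esub>"
proof
  have all: "f ` D = D" if "D \<in> flags r" for D
    by (rule flag_connected_induct[OF C that]) (use fixes_C Aut_adj_flag[OF f] in auto)
  fix x
  show "f x = \<one>\<^bsub>Aut\<^esub> x"
  proof (cases "x \<in> Field r")
    case True
    obtain D where D: "D \<in> flags r" "x \<in> D" using face_in_flag[OF True] .
    then have "f x \<in> D" using all by blast
    then have "f x = x"
      using inj_onD[OF inj_on_face_rank[OF D(1)] face_rank_Aut[OF f True]] D(2) by blast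
    then show ?thesis using True by (simp add: one_Aut)
  next
    case False
    \<comment> \<open>Outside the face set both functions take the default value
      \<open>undefined\<close>, as members of \<open>Bij\<close> are extensional.\<close>
    have "f \<in> extensional (Field r)" using f by (simp add: carrier_Aut Bij_imp_extensional)
    then show ?thesis using False by (simp add: one_Aut extensional_def)
  qed
qed

lemma Aut_eqI:
  assumes "f \<in> carrier Aut" "g \<in> carrier Aut" "C \<in> flags r" "f ` C = g ` C"
  shows "f = g"
proof -
  have "(inv\<^bsub>Aut\<^esub> f \<otimes>\<^bsub>Aut\<^esub> g) ` C = (inv\<^bsub>Aut\<^esub> f \<otimes>\<^bsub>Aut\<^esub> f) ` C"
    using assms by (simp only: mult_Aut_image Aut.inv_closed)
  then have "inv\<^bsub>Aut\<^esub> f \<otimes>\<^bsub>Aut\<^esub> g = \<one>\<^bsub>Aut\<^esub>"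
    using assms by (intro Aut_fixing_flag) (simp_all add: one_Aut_image)
  then show ?thesis
    using assms Aut.inv_equality[of "inv\<^bsub>Aut\<^esub> f" g] by (metis Aut.inv_closed Aut.inv_inv)
qed

lemma the_Aut_eq:
  assumes "C \<in> flags r" "f \<in> carrier Aut" "f ` C = D"
  shows "(THE f. f \<in> carrier Aut \<and> f ` C = D) = f"
  using assms Aut_eqI by (intro the_equality) auto

text \<open>Serves chiral and regular polytopes alike, since the effect on the base flag is all that
  the calculation needs to know about the rotations.\<close>

lemma W_relations_rotations:
  assumes C: "C \<in> flags r"
    and s: "\<And>i. 1 \<le> i \<Longrightarrow> i < n \<Longrightarrow> s i \<in> carrier Aut"
    and image: "\<And>i. 1 \<le> i \<Longrightarrow> i < n \<Longrightarrow> s i ` C = adj_flag r i (adj_flag r (i - 1) C)"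
  shows "W_relations n Aut s"
  unfolding W_relations_def
proof (intro conjI allI impI)
  show s_closed: "s ` {1..<n} \<subseteq> carrier Aut" using s by auto
  note closed = word_eval_closed[OF group_Aut s_closed ascending_in_words]
  \<comment> \<open>Induction downwards from \<open>i = j\<close>. The new factor \<open>s i\<close>
    passes through the adjacencies already present and acts on \<open>C\<close>; the adjacency at
    \<open>i\<close> it creates then cancels the existing one.\<close>
  have product: "word_eval Aut s (ascending i j) ` C = adj_flag r j (adj_flag r (i - 1) C)"
    if "i \<le> j" "1 \<le> i" "j < n" for i j
    using that
  proof (induction i rule: inc_induct)
    case base
    then show ?case using image s by (simp add: ascending_Cons) (simp add: ascending_def)
  next
    case (step i)
    have i: "1 \<le> i" "i < n" "i - 1 < n" using step by auto
    have "word_eval Aut s (ascending i j) ` C = s i ` word_eval Aut s (ascending (Suc i) j) ` C"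
      using step i s closed[of "Suc i" j] C by (simp add: ascending_Cons mult_Aut_image)
    also have "\<dots> = s i ` adj_flag r j (adj_flag r i C)"
      using step by simp
    also have "\<dots> = adj_flag r j (adj_flag r i (s i ` C))"
      using step i s C by (simp add: Aut_adj_flag adj_flag_in_flags)
    also have "\<dots> = adj_flag r j (adj_flag r (i - 1) C)"
      using image i C adj_flag_in_flags adj_flag_involution by simp
    finally show ?case .
  qed
  fix i j :: nat assume ij: "1 \<le> i" "i < j" "j < n"
  let ?w = "word_eval Aut s (ascending i j)"
  have w: "?w \<in> carrier Aut" using closed ij by blast
  have i: "i - 1 < n" using ij by simp
  \<comment> \<open>From \<open>i < j\<close> the ranks \<open>i - 1\<close> and \<open>j\<close>
    are at least two apart, so the adjacencies commute and cancel in pairs.\<close>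
  have "(?w \<otimes>\<^bsub>Aut\<^esub> ?w) ` C = adj_flag r j (adj_flag r (i - 1) (adj_flag r j (adj_flag r (i - 1) C)))"
    using product[of i j] ij i w C by (simp add: mult_Aut_image Aut_adj_flag adj_flag_in_flags)
  also have "\<dots> = C"
    using adj_flag_commute[of "adj_flag r (i - 1) C" "i - 1" j] ij i C adj_flag_in_flags
    by (simp add: adj_flag_involution)
  finally show "?w \<otimes>\<^bsub>Aut\<^esub> ?w = \<one>\<^bsub>Aut\<^esub>"
    using w C by (intro Aut_fixing_flag) simp_all
qed

section \<open>Flag orbits and the existence of rotations and reflections\<close>

lemma flag_in_orbit: "C \<in> flags r \<Longrightarrow> C \<in> orbit Aut (\<lambda>f C. f ` C) C"
  unfolding orbit_def using one_Aut_image by force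

lemma orbit_in_flag_orbits: "C \<in> flags r \<Longrightarrow> orbit Aut (\<lambda>f C. f ` C) C \<in> flag_orbits r"
  unfolding flag_orbits_def orbits_def by blast

lemma regular_transitive:
  assumes "regular_polytope n r" "C \<in> flags r" "D \<in> flags r"
  obtains f where "f \<in> carrier Aut" "f ` C = D"
proof -
  obtain S where "flag_orbits r = {S}"
    using assms(1) by (auto simp: regular_polytope_def card_1_singleton_iff)
  then have "orbit Aut (\<lambda>f C. f ` C) D = orbit Aut (\<lambda>f C. f ` C) C"
    using orbit_in_flag_orbits[OF assms(2)] orbit_in_flag_orbits[OF assms(3)] by simp
  then have "D \<in> orbit Aut (\<lambda>f C. f ` C) C"
    using flag_in_orbit[OF assms(3)] by simp
  then show thesis using that by (auto simp: orbit_def)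
qed

text \<open>There are two orbits and each adjacency changes the orbit, so two successive adjacencies
  lead back to the orbit of \<open>C\<close>.\<close>

lemma chiral_rotation_exists:
  assumes "chiral_polytope n r" "C \<in> flags r" "i < n" "j < n"
  obtains f where "f \<in> carrier Aut" "f ` C = adj_flag r i (adj_flag r j C)"
proof -
  let ?O = "orbit Aut (\<lambda>f C. f ` C)"
  define D where "D = adj_flag r j C"
  define E where "E = adj_flag r i D"
  have D: "D \<in> flags r" and E: "E \<in> flags r"
    using assms adj_flag_in_flags by (auto simp: D_def E_def)
  have "adjacent_flags r C D" "adjacent_flags r D E"
    using assms D adjacent_adj_flag by (auto simp: D_def E_def)
  then have "?O C \<noteq> ?O D" "?O D \<noteq> ?O E"
    using assms(1) orbit_in_flag_orbits flag_in_orbit assms(2) D E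
    unfolding chiral_polytope_def by metis+
  moreover obtain S T where "flag_orbits r = {S, T}"
    using assms(1) by (auto simp: chiral_polytope_def card_2_iff)
  then have "?O C \<in> {S, T}" "?O D \<in> {S, T}" "?O E \<in> {S, T}"
    using orbit_in_flag_orbits assms(2) D E by blast+
  ultimately have "?O C = ?O E" by auto
  then have "E \<in> ?O C" using flag_in_orbit[OF E] by simp
  then show thesis using that by (auto simp: orbit_def E_def D_def)
qed

lemma W_relations_chiral_rotation:
  assumes "chiral_polytope n r" "C \<in> flags r"
  shows "W_relations n Aut (chiral_rotation r C)"
proof -
  have "chiral_rotation r C i \<in> carrier Aut \<and>
    chiral_rotation r C i ` C = adj_flag r i (adj_flag r (i - 1) C)" if i: "1 \<le> i" "i < n" for i
  proof -
    have "i - 1 < n" using i by simp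
    then obtain f where f: "f \<in> carrier Aut" "f ` C = adj_flag r i (adj_flag r (i - 1) C)"
      using chiral_rotation_exists[OF assms i(2)] by blast
    then show ?thesis using the_Aut_eq[OF assms(2) f] by (simp add: chiral_rotation_def)
  qed
  then show ?thesis using W_relations_rotations[OF assms(2)] by blast
qed

lemma std_reflection:
  assumes "regular_polytope n r" "C \<in> flags r" "i < n"
  shows "std_reflection r C i \<in> carrier Aut" "std_reflection r C i ` C = adj_flag r i C"
proof -
  obtain f where f: "f \<in> carrier Aut" "f ` C = adj_flag r i C"
    using regular_transitive[OF assms(1,2) adj_flag_in_flags[OF assms(2,3)]] .
  then show "std_reflection r C i \<in> carrier Aut" "std_reflection r C i ` C = adj_flag r i C"
    using the_Aut_eq[OF assms(2) f] by (simp_all add: std_reflection_def)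
qed

text \<open>The second reflection sends \<open>C\<close> to its \<open>i\<close>-adjacent flag; the
  first one commutes with that adjacency and moves \<open>C\<close> inside it. This is why the
  adjacency at \<open>i - 1\<close> is the inner one.\<close>

lemma regular_rotation:
  assumes "regular_polytope n r" "C \<in> flags r" "1 \<le> i" "i < n"
  shows "regular_rotation r C i \<in> carrier Aut"
    and "regular_rotation r C i ` C = adj_flag r i (adj_flag r (i - 1) C)"
proof -
  have i: "i - 1 < n" using assms by simp
  note refl = std_reflection[OF assms(1,2) assms(4)] std_reflection[OF assms(1,2) i]
  show "regular_rotation r C i \<in> carrier Aut"
    using refl by (simp add: regular_rotation_def)
  show "regular_rotation r C i ` C = adj_flag r i (adj_flag r (i - 1) C)"
    using refl assms by (simp add: regular_rotation_def mult_Aut_image Aut_adj_flag)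
qed

lemma W_relations_regular_rotation:
  assumes "regular_polytope n r" "C \<in> flags r"
  shows "W_relations n Aut (regular_rotation r C)"
  using W_relations_rotations[OF assms(2)] regular_rotation[OF assms] by blast

text \<open>Since the action on flags is free, automorphisms may be compared on the base flag. There
  the conjugate of the rotation is the sequence of adjacencies 0, \<open>i - 1\<close>,
  \<open>i\<close>, 0, starting from \<open>C\<close>.\<close>

lemma bar_gen_regular_rotation:
  assumes reg: "regular_polytope n r" and C: "C \<in> flags r" and n: "0 < n" and i: "1 \<le> i" "i < n"
  shows "bar_gen Aut (regular_rotation r C) i =
    std_reflection r C 0 \<otimes>\<^bsub>Aut\<^esub> regular_rotation r C i \<otimes>\<^bsub>Aut\<^esub> inv\<^bsub>Aut\<^esub> std_reflection r C 0"
proof -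
  define c where "c = std_reflection r C 0"
  define t where "t = regular_rotation r C"
  have c: "c \<in> carrier Aut" "c ` C = adj_flag r 0 C"
    using std_reflection[OF reg C n] by (simp_all add: c_def)
  have t: "t j \<in> carrier Aut" "t j ` C = adj_flag r j (adj_flag r (j - 1) C)"
    if "1 \<le> j" "j < n" for j
    using regular_rotation[OF reg C that] by (simp_all add: t_def)
  note act = mult_Aut_image Aut_adj_flag adj_flag_in_flags adj_flag_involution Aut_flag
  have "(c \<otimes>\<^bsub>Aut\<^esub> c) ` C = C"
    using c C n by (simp add: act)
  then have "c \<otimes>\<^bsub>Aut\<^esub> c = \<one>\<^bsub>Aut\<^esub>"
    using c C Aut_fixing_flag by simp
  then have inv_c: "inv\<^bsub>Aut\<^esub> c = c" using c Aut.inv_equality by blast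
  have conj: "(c \<otimes>\<^bsub>Aut\<^esub> t i \<otimes>\<^bsub>Aut\<^esub> c) ` C =
    adj_flag r 0 (adj_flag r i (adj_flag r (i - 1) (adj_flag r 0 C)))"
    using c t[OF i] C n i by (simp add: act)
  consider "i = 1" | "i = 2" | "3 \<le> i" using i by linarith
  then have "bar_gen Aut t i = c \<otimes>\<^bsub>Aut\<^esub> t i \<otimes>\<^bsub>Aut\<^esub> c"
  proof cases
    case 1
    \<comment> \<open>The conjugate of the first rotation is its inverse: in the product of the two
      all adjacencies cancel.\<close>
    have "(c \<otimes>\<^bsub>Aut\<^esub> t 1 \<otimes>\<^bsub>Aut\<^esub> c \<otimes>\<^bsub>Aut\<^esub> t 1) ` C = C"
      using c t[of 1] C n i 1 by (simp add: act)
    then have "c \<otimes>\<^bsub>Aut\<^esub> t 1 \<otimes>\<^bsub>Aut\<^esub> c \<otimes>\<^bsub>Aut\<^esub> t 1 = \<one>\<^bsub>Aut\<^esub>"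
      using c t[of 1] C i 1 Aut_fixing_flag by simp
    then show ?thesis
      using c t[of 1] i 1 Aut.inv_equality[of "c \<otimes>\<^bsub>Aut\<^esub> t 1 \<otimes>\<^bsub>Aut\<^esub> c" "t 1"]
      by (simp add: bar_gen_def)
  next
    case 2
    have n2: "1 < n" "2 < n" using i 2 by auto
    \<comment> \<open>The adjacencies at 1 contributed by the last two factors cancel; what remains
      differs from the conjugate only by the order of the adjacencies at 0 and 2.\<close>
    have "(t 1 [^]\<^bsub>Aut\<^esub> (2::nat) \<otimes>\<^bsub>Aut\<^esub> t 2) ` C =
      adj_flag r 2 (adj_flag r 0 (adj_flag r 1 (adj_flag r 0 C)))"
      using t[of 1] t[of 2] C n n2 by (simp add: act numeral_2_eq_2)
    also have "\<dots> = (c \<otimes>\<^bsub>Aut\<^esub> t i \<otimes>\<^bsub>Aut\<^esub> c) ` C"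
      using conj adj_flag_commute[of "adj_flag r 1 (adj_flag r 0 C)" 0 2] C n n2 2
      by (simp add: adj_flag_in_flags)
    finally have "t 1 [^]\<^bsub>Aut\<^esub> (2::nat) \<otimes>\<^bsub>Aut\<^esub> t 2 = c \<otimes>\<^bsub>Aut\<^esub> t i \<otimes>\<^bsub>Aut\<^esub> c"
      using Aut_eqI[OF _ _ C] c t[of 1] t[of 2] n2 2 by simp
    then show ?thesis using 2 by (simp add: bar_gen_def)
  next
    case 3
    \<comment> \<open>Both \<open>i\<close> and \<open>i - 1\<close> are at least 2, so the two
      adjacencies at 0 can be brought together and cancel.\<close>
    have "(c \<otimes>\<^bsub>Aut\<^esub> t i \<otimes>\<^bsub>Aut\<^esub> c) ` C =
      adj_flag r i (adj_flag r 0 (adj_flag r (i - 1) (adj_flag r 0 C)))"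
      using conj adj_flag_commute[of "adj_flag r (i - 1) (adj_flag r 0 C)" 0 i] C n i 3
      by (simp add: adj_flag_in_flags)
    also have "\<dots> = t i ` C"
      using adj_flag_commute[of "adj_flag r 0 C" 0 "i - 1"] C n i 3 t[OF i]
      by (simp add: adj_flag_in_flags adj_flag_involution)
    finally have "c \<otimes>\<^bsub>Aut\<^esub> t i \<otimes>\<^bsub>Aut\<^esub> c = t i"
      using Aut_eqI[OF _ _ C] c t[OF i] by simp
    then show ?thesis using 3 by (simp add: bar_gen_def)
  qed
  then show ?thesis using inv_c by (simp add: c_def t_def)
qed

text \<open>Applying bar before the homomorphism amounts to conjugating after it, because both
  composites are homomorphisms that agree on generators; a conjugate of one is one.\<close>

lemma W_hom_bar_regular_rotation:
  assumes reg: "regular_polytope n r" and C: "C \<in> flags r" and x: "x \<in> carrier (W_plus n)"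
    and one: "W_hom n Aut (regular_rotation r C) x = \<one>\<^bsub>Aut\<^esub>"
  shows "W_hom n Aut (regular_rotation r C) (W_bar n x) = \<one>\<^bsub>Aut\<^esub>"
proof -
  let ?t = "regular_rotation r C"
  let ?h = "W_hom n Aut ?t"
  \<comment> \<open>For \<open>n = 0\<close> there is no reflection of rank 0. There are no
    generators either, so conjugation by one will do.\<close>
  define c where "c = (if 0 < n then std_reflection r C 0 else \<one>\<^bsub>Aut\<^esub>)"
  have c: "c \<in> carrier Aut" using std_reflection(1)[OF reg C] by (simp add: c_def)
  note rel = W_relations_regular_rotation[OF reg C]
  note hom = W_hom_hom[OF group_Aut rel]
  have "(?h \<circ> W_bar n) x = c \<otimes>\<^bsub>Aut\<^esub> ?h x \<otimes>\<^bsub>Aut\<^esub> inv\<^bsub>Aut\<^esub> c"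
  proof (rule W_plus_hom_eqI[OF group_Aut _ _ _ x])
    show "?h \<circ> W_bar n \<in> hom (W_plus n) Aut"
      using W_bar_hom hom Group.hom_compose by blast
    show "(\<lambda>x. c \<otimes>\<^bsub>Aut\<^esub> ?h x \<otimes>\<^bsub>Aut\<^esub> inv\<^bsub>Aut\<^esub> c) \<in> hom (W_plus n) Aut"
    proof (rule homI)
      fix x y assume xy: "x \<in> carrier (W_plus n)" "y \<in> carrier (W_plus n)"
      have closed: "?h x \<in> carrier Aut" "?h y \<in> carrier Aut"
        using xy hom_in_carrier[OF hom] by auto
      then show "c \<otimes>\<^bsub>Aut\<^esub> ?h x \<otimes>\<^bsub>Aut\<^esub> inv\<^bsub>Aut\<^esub> c \<in> carrier Aut" using c by simp
      have "c \<otimes>\<^bsub>Aut\<^esub> ?h x \<otimes>\<^bsub>Aut\<^esub> inv\<^bsub>Aut\<^esub> c \<otimes>\<^bsub>Aut\<^esub> (c \<otimes>\<^bsub>Aut\<^esub> ?h y \<otimes>\<^bsub>Aut\<^esub> inv\<^bsub>Aut\<^esub> c) =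
        c \<otimes>\<^bsub>Aut\<^esub> (?h x \<otimes>\<^bsub>Aut\<^esub> (inv\<^bsub>Aut\<^esub> c \<otimes>\<^bsub>Aut\<^esub> c) \<otimes>\<^bsub>Aut\<^esub> ?h y) \<otimes>\<^bsub>Aut\<^esub> inv\<^bsub>Aut\<^esub> c"
        using c closed by (simp only: Aut.m_assoc Aut.m_closed Aut.inv_closed)
      then show "c \<otimes>\<^bsub>Aut\<^esub> ?h (x \<otimes>\<^bsub>W_plus n\<^esub> y) \<otimes>\<^bsub>Aut\<^esub> inv\<^bsub>Aut\<^esub> c =
        c \<otimes>\<^bsub>Aut\<^esub> ?h x \<otimes>\<^bsub>Aut\<^esub> inv\<^bsub>Aut\<^esub> c \<otimes>\<^bsub>Aut\<^esub> (c \<otimes>\<^bsub>Aut\<^esub> ?h y \<otimes>\<^bsub>Aut\<^esub> inv\<^bsub>Aut\<^esub> c)"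
        using c closed hom_mult[OF hom xy] by simp
    qed
    fix i assume i: "i \<in> {1..<n}"
    have "(?h \<circ> W_bar n) (W_gen n i) = bar_gen Aut (?h \<circ> W_gen n) i"
      using hom_bar_gen[OF group_W_plus group_Aut hom W_relations_closed[OF W_relations_W_gen] i]
        W_bar_gen[OF i] by simp
    also have "\<dots> = bar_gen Aut ?t i"
      using i W_hom_gen[OF group_Aut rel] by (auto simp: bar_gen_def)
    also have "\<dots> = c \<otimes>\<^bsub>Aut\<^esub> ?t i \<otimes>\<^bsub>Aut\<^esub> inv\<^bsub>Aut\<^esub> c"
      using bar_gen_regular_rotation[OF reg C, of i] i by (simp add: c_def)
    finally show "(?h \<circ> W_bar n) (W_gen n i) =
      c \<otimes>\<^bsub>Aut\<^esub> ?h (W_gen n i) \<otimes>\<^bsub>Aut\<^esub> inv\<^bsub>Aut\<^esub> c"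
      using W_hom_gen[OF group_Aut rel i] by simp
  qed
  then show ?thesis using one c by simp
qed

end

section \<open>Chirality groups of mixes\<close>

text \<open>By the first isomorphism theorem the image is as large as the set of cosets of the
  kernel, whose number divides the order by Lagrange.\<close>

lemma order_image_dvd_order:
  assumes "group G" "group H" "h \<in> hom G H" "finite (carrier G)"
  shows "card (h ` carrier G) dvd order G"
proof -
  interpret group_hom G H h using assms by (simp add: group_hom_def group_hom_axioms_def)
  \<comment> \<open>Restricting the target to the image makes the homomorphism surjective, as the
    isomorphism theorem demands.\<close>
  let ?I = "H\<lparr>carrier := h ` carrier G\<rparr>"
  have "subgroup (h ` carrier G) H" by (rule img_is_subgroup)
  then interpret I: group ?I by (rule subgroup.subgroup_is_group) (rule H.is_group)
  interpret I: group_hom G ?I h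
    using homh by unfold_locales (auto simp: hom_def)
  have "card (carrier (G Mod kernel G ?I h)) = card (carrier ?I)"
    using I.FactGroup_iso by (intro iso_same_card) simp
  then have "card (rcosets\<^bsub>G\<^esub> (kernel G ?I h)) = card (h ` carrier G)"
    by (simp add: FactGroup_def)
  then show ?thesis using G.lagrange[OF I.subgroup_kernel] by (metis dvd_triv_left)
qed

text \<open>
  If \<open>L \<inter> ker \<psi>\<close> were killed by \<open>\<phi>\<close>, then \<open>\<phi>\<close> would factor through \<open>\<psi>\<close> on \<open>L\<close>, making
  \<open>\<phi> ` L\<close> a quotient of the subgroup \<open>\<psi> ` L\<close> of \<open>H\<close>.
\<close>

lemma image_Int_kernel_eq:
  assumes W: "group W" and G: "group G" and H: "group H"
    and phi: "\<phi> \<in> hom W G" and psi: "\<psi> \<in> hom W H" and L: "subgroup L W"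
    and simple: "simple_group (G\<lparr>carrier := \<phi> ` L\<rparr>)"
    and dvd: "\<not> card (\<phi> ` L) dvd order H"
  shows "\<phi> ` (L \<inter> kernel W H \<psi>) = \<phi> ` L"
proof -
  interpret W: group W by fact
  interpret G: group_hom W G \<phi> using assms by (simp add: group_hom_def group_hom_axioms_def)
  interpret H: group_hom W H \<psi> using assms by (simp add: group_hom_def group_hom_axioms_def)
  interpret X: simple_group "G\<lparr>carrier := \<phi> ` L\<rparr>" by fact
  let ?X = "G\<lparr>carrier := \<phi> ` L\<rparr>"
  let ?L = "W\<lparr>carrier := L\<rparr>"
  have L_closed: "x \<in> carrier W" if "x \<in> L" for x
    using subgroup.mem_carrier[OF L that] .
  have sub: "subgroup (L \<inter> kernel W H \<psi>) W"
    using W.subgroups_Inter_pair[OF L H.subgroup_kernel] .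
  have sub_X: "subgroup (\<phi> ` L) G" using G.subgroup_img_is_subgroup[OF L] .
  \<comment> \<open>Elements of \<open>?X\<close> lift to \<open>L\<close>; conjugation by the lifts
    preserves \<open>L\<close> and the kernel.\<close>
  have "\<phi> ` (L \<inter> kernel W H \<psi>) \<lhd> ?X"
  proof (rule X.normal_invI)
    show "subgroup (\<phi> ` (L \<inter> kernel W H \<psi>)) ?X"
      using G.H.subgroup_incl[OF G.subgroup_img_is_subgroup[OF sub] sub_X] by blast
    fix x h assume "x \<in> carrier ?X" "h \<in> \<phi> ` (L \<inter> kernel W H \<psi>)"
    then obtain a b where a: "a \<in> L" "x = \<phi> a" and b: "b \<in> L" "b \<in> kernel W H \<psi>" "h = \<phi> b"
      by auto
    have "a \<otimes>\<^bsub>W\<^esub> b \<otimes>\<^bsub>W\<^esub> inv\<^bsub>W\<^esub> a \<in> L"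
      using a b L by (simp add: subgroup.m_closed subgroup.m_inv_closed)
    moreover have "a \<otimes>\<^bsub>W\<^esub> b \<otimes>\<^bsub>W\<^esub> inv\<^bsub>W\<^esub> a \<in> kernel W H \<psi>"
      using a b L_closed by (simp add: kernel_def)
    moreover have "\<phi> (a \<otimes>\<^bsub>W\<^esub> b \<otimes>\<^bsub>W\<^esub> inv\<^bsub>W\<^esub> a) = x \<otimes>\<^bsub>?X\<^esub> h \<otimes>\<^bsub>?X\<^esub> inv\<^bsub>?X\<^esub> x"
      using a b L_closed G.H.m_inv_consistent[OF sub_X] by simp
    ultimately show "x \<otimes>\<^bsub>?X\<^esub> h \<otimes>\<^bsub>?X\<^esub> inv\<^bsub>?X\<^esub> x \<in> \<phi> ` (L \<inter> kernel W H \<psi>)"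
      by (metis IntI imageI)
  qed
  moreover have "\<phi> ` (L \<inter> kernel W H \<psi>) \<noteq> {\<one>\<^bsub>?X\<^esub>}"
  proof
    assume trivial: "\<phi> ` (L \<inter> kernel W H \<psi>) = {\<one>\<^bsub>?X\<^esub>}"
    have factors: "\<phi> x = \<phi> y" if xy: "x \<in> L" "y \<in> L" "\<psi> x = \<psi> y" for x y
    proof -
      have "x \<otimes>\<^bsub>W\<^esub> inv\<^bsub>W\<^esub> y \<in> L \<inter> kernel W H \<psi>"
        using xy L L_closed by (simp add: kernel_def subgroup.m_closed subgroup.m_inv_closed)
      then have "\<phi> (x \<otimes>\<^bsub>W\<^esub> inv\<^bsub>W\<^esub> y) = \<one>\<^bsub>G\<^esub>" using trivial by auto
      then have "\<phi> x \<otimes>\<^bsub>G\<^esub> inv\<^bsub>G\<^esub> \<phi> y = \<one>\<^bsub>G\<^esub>" using xy L_closed by simp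
      then show ?thesis
        using xy L_closed G.H.inv_equality[of "\<phi> x" "inv\<^bsub>G\<^esub> \<phi> y"] by simp
    qed
    \<comment> \<open>The induced map from \<open>\<psi>\<close> L\<open>to\<close>\<phi>
      \<open>L\<close>; by \<open>factors\<close> the choice of the preimage does not
      matter.\<close>
    define g where "g = (\<lambda>y. \<phi> (SOME x. x \<in> L \<and> \<psi> x = y))"
    have g: "g (\<psi> x) = \<phi> x" if "x \<in> L" for x
    proof -
      have "\<exists>z. z \<in> L \<and> \<psi> z = \<psi> x" using that by blast
      from someI_ex[OF this] show ?thesis unfolding g_def using factors that by blast
    qed
    have sub_Y: "subgroup (\<psi> ` L) H" using H.subgroup_img_is_subgroup[OF L] .
    let ?Y = "H\<lparr>carrier := \<psi> ` L\<rparr>"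
    have Y: "group ?Y" by (rule H.H.subgroup_imp_group[OF sub_Y])
    have "g \<in> hom ?Y G"
    proof (rule homI)
      fix x assume "x \<in> carrier ?Y"
      then obtain a where a: "a \<in> L" "x = \<psi> a" by auto
      then show "g x \<in> carrier G" using g L_closed by simp
      fix y assume "y \<in> carrier ?Y"
      then obtain b where b: "b \<in> L" "y = \<psi> b" by auto
      have "a \<otimes>\<^bsub>W\<^esub> b \<in> L" using a b L subgroup.m_closed by metis
      from g[OF this] show "g (x \<otimes>\<^bsub>?Y\<^esub> y) = g x \<otimes>\<^bsub>G\<^esub> g y" using a b g L_closed by simp
    qed
    \<comment> \<open>An infinite group has \<open>order\<close> 0, which every number divides, so
      the failure of divisibility already forces \<open>H\<close> to be finite.\<close>
    moreover have fin: "finite (carrier H)"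
      using dvd by (metis H.H.order_gt_0_iff_finite dvd_0_right gr0I)
    then have "finite (carrier ?Y)"
      using subgroup.subset[OF sub_Y] finite_subset by auto
    ultimately have "card (g ` carrier ?Y) dvd order ?Y"
      using order_image_dvd_order[OF Y G] by blast
    moreover have "g ` carrier ?Y = \<phi> ` L"
      using g by (force simp: image_image)
    moreover have "order ?Y dvd order H"
      using H.H.lagrange[OF sub_Y] by (simp add: order_def[of ?Y]) (metis dvd_triv_right)
    ultimately show False using dvd dvd_trans by metis
  qed
  ultimately show ?thesis using X.no_real_normal_subgroup by fastforce
qed

section \<open>Homomorphisms from W+ into generated subgroups and products\<close>

lemma (in group) id_hom_subgroup_generated: "id \<in> hom (subgroup_generated G S) G"
  using subsetD[OF carrier_subgroup_generated_subset]
  by (auto simp: hom_def)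

text \<open>Inverses in the generated subgroup are formed anew, but the inclusion is a homomorphism,
  so words have the same values in both groups.\<close>

lemma W_relations_subgroup_generated:
  assumes "group G" "W_relations n G s"
  shows "W_relations n (subgroup_generated G (s ` {1..<n})) s"
proof -
  interpret group G by fact
  let ?H = "subgroup_generated G (s ` {1..<n})"
  note s = W_relations_closed[OF assms(2)]
  have sH: "s ` {1..<n} \<subseteq> carrier ?H"
    using subgroup_generated_subset_carrier_subset[OF s] .
  have eval: "word_eval ?H s w = word_eval G s w" if "w \<in> words {1..<n}" for w
    using word_eval_hom[OF group_subgroup_generated assms(1) id_hom_subgroup_generated sH that]
    by simp
  show ?thesis
    unfolding W_relations_def
  proof (intro conjI allI impI)
    fix i j :: nat assume ij: "1 \<le> i" "i < j" "j < n"
    show "word_eval ?H s (ascending i j) \<otimes>\<^bsub>?H\<^esub> word_eval ?H s (ascending i j) = \<one>\<^bsub>?H\<^esub>"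
      using W_relations_square[OF assms(2) ij] eval[OF ascending_in_words[OF ij(1,3)]]
      by (simp add: subgroup_generated_def)
  qed (rule sH)
qed

lemma W_hom_compose:
  assumes "group G" "group H" "h \<in> hom G H" "W_relations n G s" "W_relations n H (h \<circ> s)"
    and "x \<in> carrier (W_plus n)"
  shows "h (W_hom n G s x) = W_hom n H (h \<circ> s) x"
proof -
  have "(h \<circ> W_hom n G s) x = W_hom n H (h \<circ> s) x"
  proof (rule W_plus_hom_eqI[OF assms(2) _ _ _ assms(6)])
    show "h \<circ> W_hom n G s \<in> hom (W_plus n) H"
      using W_hom_hom[OF assms(1,4)] assms(3) Group.hom_compose by blast
    show "W_hom n H (h \<circ> s) \<in> hom (W_plus n) H" by (rule W_hom_hom[OF assms(2,5)])
    show "\<And>i. i \<in> {1..<n} \<Longrightarrow> (h \<circ> W_hom n G s) (W_gen n i) = W_hom n H (h \<circ> s) (W_gen n i)"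
      using W_hom_gen[OF assms(1,4)] W_hom_gen[OF assms(2,5)] by simp
  qed
  then show ?thesis by simp
qed

lemma W_relations_DirProd:
  assumes "group G" "group H" "W_relations n G s" "W_relations n H t"
  shows "W_relations n (G \<times>\<times> H) (\<lambda>i. (s i, t i))"
proof -
  let ?u = "\<lambda>i. (s i, t i)"
  have D: "group (G \<times>\<times> H)" using DirProd_group assms by blast
  have u: "?u ` {1..<n} \<subseteq> carrier (G \<times>\<times> H)"
    using W_relations_closed[OF assms(3)] W_relations_closed[OF assms(4)] by auto
  have fst: "fst \<in> hom (G \<times>\<times> H) G" and snd: "snd \<in> hom (G \<times>\<times> H) H"
    by (auto simp: hom_def)
  have eval: "word_eval (G \<times>\<times> H) ?u w = (word_eval G s w, word_eval H t w)"
    if "w \<in> words {1..<n}" for w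
    using word_eval_hom[OF D assms(1) fst u that] word_eval_hom[OF D assms(2) snd u that]
    by (simp add: prod_eq_iff comp_def)
  show ?thesis
    unfolding W_relations_def
  proof (intro conjI allI impI)
    fix i j :: nat assume ij: "1 \<le> i" "i < j" "j < n"
    show "word_eval (G \<times>\<times> H) ?u (ascending i j) \<otimes>\<^bsub>G \<times>\<times> H\<^esub>
      word_eval (G \<times>\<times> H) ?u (ascending i j) = \<one>\<^bsub>G \<times>\<times> H\<^esub>"
      using W_relations_square[OF assms(3) ij] W_relations_square[OF assms(4) ij]
        eval[OF ascending_in_words[OF ij(1,3)]] by simp
  qed (rule u)
qed

text \<open>In the product of the kernel with its bar image the first factor is sent to one, so only
  the bar image contributes.\<close>

lemma chirality_group_carrier:
  assumes "group G" "W_relations n G s"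
  shows "carrier (chirality_group n (G, s)) = W_hom n G s ` W_bar n ` rot_kernel n (G, s)"
proof -
  interpret group_hom "W_plus n" G "W_hom n G s"
    using assms W_hom_hom group_W_plus by (simp add: group_hom_def group_hom_axioms_def)
  let ?M = "rot_kernel n (G, s)"
  have M: "?M = kernel (W_plus n) G (W_hom n G s)" by (simp add: rot_kernel_def)
  have bar: "W_bar n x \<in> carrier (W_plus n)" if "x \<in> ?M" for x
    using that hom_in_carrier[OF W_bar_hom] by (simp add: M kernel_def)
  have "W_hom n G s (x \<otimes>\<^bsub>W_plus n\<^esub> W_bar n y) = W_hom n G s (W_bar n y)" if "x \<in> ?M" "y \<in> ?M" for x y
    using that bar[OF that(2)] by (simp add: M kernel_def)
  moreover have "\<one>\<^bsub>W_plus n\<^esub> \<in> ?M" by (simp add: M kernel_def)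
  ultimately show ?thesis
    unfolding chirality_group_def set_mult_def by (auto simp: image_iff)
qed

text \<open>The group-theoretic core. The second polytope enters through the invariance of its
  kernel under bar and through the order of its rotation group.\<close>

lemma mix_chirality_group:
  fixes G :: "'g monoid" and H :: "'h monoid"
  assumes G: "group G" and H: "group H" and s: "W_relations n G s" and t: "W_relations n H t"
    and bar: "\<And>x. x \<in> carrier (W_plus n) \<Longrightarrow> W_hom n H t x = \<one>\<^bsub>H\<^esub> \<Longrightarrow>
      W_hom n H t (W_bar n x) = \<one>\<^bsub>H\<^esub>"
    and simple: "simple_group (chirality_group n (G, s))"
    and dvd: "\<not> order (chirality_group n (G, s)) dvd order H"
  shows "chiral_rot n (mix n (G, s) (H, t)) \<and>
    carrier (chirality_group n (mix n (G, s) (H, t))) =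
      carrier (chirality_group n (G, s)) \<times> {\<one>\<^bsub>H\<^esub>} \<and>
    chirality_group n (mix n (G, s) (H, t)) \<cong> chirality_group n (G, s)"
proof -
  let ?W = "W_plus n" and ?bar = "W_bar n"
  let ?phi = "W_hom n G s" and ?psi = "W_hom n H t"
  let ?X = "chirality_group n (G, s)"
  define M where "M = rot_kernel n (G, s)"
  define K where "K = kernel ?W H ?psi"
  define L where "L = ?bar ` M"
  define u where "u = (\<lambda>i. (s i, t i))"
  define D where "D = subgroup_generated (G \<times>\<times> H) (u ` {1..<n})"
  have mix: "mix n (G, s) (H, t) = (D, u)" by (simp add: mix_def D_def u_def)
  interpret G: group_hom ?W G ?phi
    using G s W_hom_hom group_W_plus by (simp add: group_hom_def group_hom_axioms_def)
  interpret B: group_hom ?W ?W ?bar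
    using W_bar_hom group_W_plus by (simp add: group_hom_def group_hom_axioms_def)
  have M_eq: "M = kernel ?W G ?phi" by (simp add: M_def rot_kernel_def)
  have L: "subgroup L ?W"
    unfolding L_def M_eq by (rule B.subgroup_img_is_subgroup[OF G.subgroup_kernel])
  have X: "carrier ?X = ?phi ` L"
    using chirality_group_carrier[OF G s] by (simp add: L_def M_def)
  moreover have "?X = G\<lparr>carrier := carrier ?X\<rparr>"
    by (simp add: chirality_group_def)
  ultimately have "?X = G\<lparr>carrier := ?phi ` L\<rparr>" by simp
  then have image: "?phi ` (L \<inter> K) = ?phi ` L"
    unfolding K_def
    using simple dvd image_Int_kernel_eq[OF group_W_plus G H W_hom_hom[OF G s] W_hom_hom[OF H t] L]
    by (simp add: order_def)
  have DP: "group (G \<times>\<times> H)" using DirProd_group G H by blast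
  then have D: "group D" by (simp add: D_def group.group_subgroup_generated)
  have D_sub: "carrier D \<subseteq> carrier (G \<times>\<times> H)"
    unfolding D_def by (rule group.carrier_subgroup_generated_subset[OF DP])
  have D_ops: "monoid.mult D = monoid.mult (G \<times>\<times> H)" "\<one>\<^bsub>D\<^esub> = (\<one>\<^bsub>G\<^esub>, \<one>\<^bsub>H\<^esub>)"
    by (simp_all add: D_def subgroup_generated_def)
  have u: "W_relations n D u"
    unfolding D_def u_def
    by (intro W_relations_subgroup_generated DP W_relations_DirProd G H s t)
  have fst: "fst \<in> hom D G" and snd: "snd \<in> hom D H"
    using D_sub by (auto simp: hom_def D_ops)
  \<comment> \<open>The two projections of the mix are homomorphisms, so by
    \<open>W_hom_compose\<close> the map into the mix is the pair of the maps into the factors, and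
    its kernel is the intersection of theirs.\<close>
  have Phi: "W_hom n D u x = (?phi x, ?psi x)" if "x \<in> carrier ?W" for x
    using W_hom_compose[OF D G fst u _ that] W_hom_compose[OF D H snd u _ that] s t
    by (simp add: prod_eq_iff u_def comp_def)
  have N: "rot_kernel n (D, u) = M \<inter> K"
    using Phi by (auto simp: rot_kernel_def kernel_def M_eq K_def D_ops)
  \<comment> \<open>As bar is its own inverse and maps \<open>K\<close> into \<open>K\<close>, an
    element of \<open>K\<close> and its bar image lie in \<open>K\<close> together.\<close>
  have bar_N: "?bar ` (M \<inter> K) = L \<inter> K"
  proof (intro subset_antisym subsetI)
    fix y assume "y \<in> ?bar ` (M \<inter> K)"
    then show "y \<in> L \<inter> K" using bar by (auto simp: L_def K_def kernel_def)
  next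
    fix y assume "y \<in> L \<inter> K"
    then obtain m where m: "m \<in> M" "y = ?bar m" "y \<in> K" by (auto simp: L_def)
    then have "m = ?bar y" "m \<in> carrier ?W"
      using W_bar_W_bar by (auto simp: M_eq kernel_def)
    then have "m \<in> K" using m(3) bar by (auto simp: K_def kernel_def)
    then show "y \<in> ?bar ` (M \<inter> K)" using m by blast
  qed
  have carrier: "carrier (chirality_group n (D, u)) = carrier ?X \<times> {\<one>\<^bsub>H\<^esub>}"
  proof -
    have "carrier (chirality_group n (D, u)) = W_hom n D u ` (L \<inter> K)"
      using chirality_group_carrier[OF D u] by (simp add: N bar_N)
    also have "\<dots> = (\<lambda>x. (?phi x, \<one>\<^bsub>H\<^esub>)) ` (L \<inter> K)"
      by (rule image_cong) (use Phi in \<open>auto simp: K_def kernel_def\<close>)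
    also have "\<dots> = ?phi ` (L \<inter> K) \<times> {\<one>\<^bsub>H\<^esub>}" by auto
    finally show ?thesis using image X by simp
  qed
  have chiral: "chiral_rot n (D, u)"
    unfolding chiral_rot_def N bar_N
  proof
    \<comment> \<open>Then \<open>?phi\<close> kills \<open>L \<inter> K\<close>, whose image is all
      of the chirality group of the first factor; that group would be trivial, which simplicity
      excludes.\<close>
    assume "L \<inter> K = M \<inter> K"
    then have "?phi ` L \<subseteq> {\<one>\<^bsub>G\<^esub>}" using image by (auto simp: M_eq kernel_def)
    then have "card (carrier ?X) \<le> 1" unfolding X using card_mono[of "{\<one>\<^bsub>G\<^esub>}"] by simp
    then show False using simple_group.order_gt_one[OF simple] by (simp add: order_def)
  qed
  have "fst \<in> iso (chirality_group n (D, u)) ?X"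
  proof (rule isoI)
    show "fst \<in> hom (chirality_group n (D, u)) ?X"
    proof (rule homI)
      fix x y assume "x \<in> carrier (chirality_group n (D, u))" "y \<in> carrier (chirality_group n (D, u))"
      then show "fst x \<in> carrier ?X"
        and "fst (x \<otimes>\<^bsub>chirality_group n (D, u)\<^esub> y) = fst x \<otimes>\<^bsub>?X\<^esub> fst y"
        by (auto simp: carrier) (auto simp: chirality_group_def D_ops)
    qed
    show "bij_betw fst (carrier (chirality_group n (D, u))) (carrier ?X)"
      unfolding carrier by (auto simp: bij_betw_def inj_on_def)
  qed
  then have "chirality_group n (D, u) \<cong> ?X" by (auto simp: is_iso_def)
  with chiral carrier show ?thesis by (simp add: mix)
qed

text \<open>The chirality group of the mix consists of pairs, so its equality with X(P) means
  equality with the copy of X(P) in the first factor.\<close>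

theorem theorem4p6:
  fixes n :: nat and P :: "'a rel" and Q :: "'b rel" and C :: "'a set" and D :: "'b set"
  assumes "finite (Field P)" and "chiral_polytope n P" and "C \<in> flags P"
    and "finite (Field Q)" and "directly_regular_polytope n Q" and "D \<in> flags Q"
    and "simple_group (chirality_group n (chiral_rotation_group P C))"
    and "\<not> order (chirality_group n (chiral_rotation_group P C))
           dvd order (fst (regular_rotation_group n Q D))"
  shows "chiral_rot n (mix n (chiral_rotation_group P C) (regular_rotation_group n Q D)) \<and>
    carrier (chirality_group n (mix n (chiral_rotation_group P C) (regular_rotation_group n Q D)))
      = carrier (chirality_group n (chiral_rotation_group P C))
          \<times> {\<one>\<^bsub>fst (regular_rotation_group n Q D)\<^esub>} \<and>
    chirality_group n (mix n (chiral_rotation_group P C) (regular_rotation_group n Q D))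
      \<cong> chirality_group n (chiral_rotation_group P C)"
proof -
  have reg: "regular_polytope n Q" using assms(5) by (simp add: directly_regular_polytope_def)
  interpret P: finite_polytope n P
    using assms(1,2) by unfold_locales (simp_all add: chiral_polytope_def)
  interpret Q: finite_polytope n Q
    using assms(4) reg by unfold_locales (simp_all add: regular_polytope_def)
  let ?t = "regular_rotation Q D"
  let ?H = "subgroup_generated (aut_group Q) (?t ` {1..<n})"
  have t: "W_relations n (aut_group Q) ?t" by (rule Q.W_relations_regular_rotation[OF reg assms(6)])
  have tH: "W_relations n ?H ?t" by (rule W_relations_subgroup_generated[OF Q.group_Aut t])
  have H: "group ?H" by (rule Q.Aut.group_subgroup_generated)
  \<comment> \<open>Conjugation by rho_0 takes place in the full automorphism group, while the
    rotation group of \<open>Q\<close> is a generated subgroup. The values agree along the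
    inclusion, so invariance of the kernel carries over.\<close>
  have W_hom_H: "W_hom n ?H ?t x = W_hom n (aut_group Q) ?t x" if "x \<in> carrier (W_plus n)" for x
    using W_hom_compose[OF H Q.group_Aut Q.Aut.id_hom_subgroup_generated tH _ that] t by simp
  have "W_hom n ?H ?t (W_bar n x) = \<one>\<^bsub>?H\<^esub>"
    if "x \<in> carrier (W_plus n)" "W_hom n ?H ?t x = \<one>\<^bsub>?H\<^esub>" for x
    using that W_hom_H hom_in_carrier[OF W_bar_hom that(1)]
      Q.W_hom_bar_regular_rotation[OF reg assms(6) that(1)]
    by (simp add: subgroup_generated_def)
  then show ?thesis
    using mix_chirality_group[OF P.group_Aut H
        P.W_relations_chiral_rotation[OF assms(2,3)] tH] assms(7,8)
    by (simp add: chiral_rotation_group_def regular_rotation_group_def)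
qed

end
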